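(* Let $G$ be a finitely generated group, and let $\lambda$ be the left regular representation of $G$ on the real Hilbert space $L^2(G)$. Then $G$ is amenable if and only if there exists a nonzero homomorphism of abelian groups $\varphi \colon L^2(G) \to \mathbb{T} = \mathbb{R}/\mathbb{Z}$ (not necessarily continuous) that is invariant under the $G$-action: $\varphi(f) = \varphi(\lambda_g f)$ for all $f \in L^2(G)$ and $g \in G$.
   Context: $L^2(G)$ is the real Hilbert space of square-summable functions $f \colon G \to \mathbb{R}$ on the discrete group $G$, and $[\lambda_g f](h) = f(g^{-1}h)$. A homomorphism $\varphi \colon L^2(G)\to\mathbb{T}$ is an additive map: $\varphi(f_1+f_2)=\varphi(f_1)+\varphi(f_2)$. *)

theory Defs
  imports "HOL-Algebra.Algebra" "HOL-Analysis.Infinite_Sum"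
begin

definition finitely_generated_group :: "('a, 'b) monoid_scheme \<Rightarrow> bool" where
  "finitely_generated_group G \<longleftrightarrow>
     group G \<and> (\<exists>S. finite S \<and> S \<subseteq> carrier G \<and> generate G S = carrier G)"

(* Amenability of a discrete group in von Neumann's sense: a left-invariant, finitely additive
   probability measure defined on all subsets. *)
definition amenable :: "('a, 'b) monoid_scheme \<Rightarrow> bool" where
  "amenable G \<longleftrightarrow>
     (\<exists>\<mu> :: 'a set \<Rightarrow> real.
        (\<forall>A. A \<subseteq> carrier G \<longrightarrow> 0 \<le> \<mu> A) \<and>
        \<mu> (carrier G) = 1 \<and>
        (\<forall>A B. A \<subseteq> carrier G \<longrightarrow> B \<subseteq> carrier G \<longrightarrow> A \<inter> B = {} \<longrightarrow> \<mu> (A \<union> B) = \<mu> A + \<mu> B) \<and>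
        (\<forall>g \<in> carrier G. \<forall>A. A \<subseteq> carrier G \<longrightarrow> \<mu> (g <#\<^bsub>G\<^esub> A) = \<mu> A))"

(* A function on the group is represented by its unique extension that is undefined off the
   carrier. *)
definition L2 :: "('a, 'b) monoid_scheme \<Rightarrow> ('a \<Rightarrow> real) set" where
  "L2 G = {f \<in> extensional (carrier G). (\<lambda>x. (f x)\<^sup>2) summable_on carrier G}"

definition L2_group :: "('a, 'b) monoid_scheme \<Rightarrow> ('a \<Rightarrow> real) monoid" where
  "L2_group G =
     \<lparr>carrier = L2 G, monoid.mult = (\<lambda>f1 f2. \<lambda>x\<in>carrier G. f1 x + f2 x), one = (\<lambda>x\<in>carrier G. 0)\<rparr>"

definition left_regular :: "('a, 'b) monoid_scheme \<Rightarrow> 'a \<Rightarrow> ('a \<Rightarrow> real) \<Rightarrow> ('a \<Rightarrow> real)" where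
  "left_regular G g f = (\<lambda>h\<in>carrier G. f (inv\<^bsub>G\<^esub> g \<otimes>\<^bsub>G\<^esub> h))"

definition real_group :: "real monoid" where
  "real_group = \<lparr>carrier = UNIV, monoid.mult = (+), one = 0\<rparr>"

definition circle_group :: "real set monoid" where
  "circle_group = real_group Mod \<int>"

lemma comm_group_real_group: "comm_group real_group"
proof (rule comm_groupI)
  fix x assume "x \<in> carrier real_group"
  show "\<exists>y\<in>carrier real_group. y \<otimes>\<^bsub>real_group\<^esub> x = \<one>\<^bsub>real_group\<^esub>"
    by (rule bexI[of _ "- x"]) (auto simp: real_group_def)
qed (auto simp: real_group_def)

lemma inv_real_group: "inv\<^bsub>real_group\<^esub> x = - x"
proof -
  interpret comm_group real_group by (rule comm_group_real_group)
  show ?thesis by (rule inv_equality) (auto simp: real_group_def)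
qed

lemma comm_group_circle_group: "comm_group circle_group"
proof -
  interpret comm_group real_group by (rule comm_group_real_group)
  have "subgroup \<int> real_group"
    by (rule subgroup.intro) (auto simp: inv_real_group, auto simp: real_group_def)
  then show ?thesis unfolding circle_group_def by (rule abelian_FactGroup)
qed

lemma L2_add:
  assumes "f1 \<in> L2 G" "f2 \<in> L2 G"
  shows "(\<lambda>x\<in>carrier G. f1 x + f2 x) \<in> L2 G"
proof -
  have "(\<lambda>x. 2 * (f1 x)\<^sup>2 + 2 * (f2 x)\<^sup>2) summable_on carrier G"
    using assms by (intro summable_on_add summable_on_cmult_right) (auto simp: L2_def)
  moreover have "(f1 x + f2 x)\<^sup>2 \<le> 2 * (f1 x)\<^sup>2 + 2 * (f2 x)\<^sup>2" for x
    using sum_squares_bound[of "f1 x" "f2 x"] by (simp add: power2_sum)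
  ultimately have "(\<lambda>x. (f1 x + f2 x)\<^sup>2) summable_on carrier G"
    by (rule summable_on_comparison_test) auto
  then show ?thesis
    by (simp add: L2_def cong: summable_on_cong)
qed

lemma L2_uminus:
  assumes "f \<in> L2 G"
  shows "(\<lambda>x\<in>carrier G. - f x) \<in> L2 G"
  using assms by (simp add: L2_def cong: summable_on_cong)

lemma comm_group_L2_group: "comm_group (L2_group G)"
proof (rule comm_groupI)
  fix f assume f: "f \<in> carrier (L2_group G)"
  show "\<exists>h\<in>carrier (L2_group G). h \<otimes>\<^bsub>L2_group G\<^esub> f = \<one>\<^bsub>L2_group G\<^esub>"
    using f L2_uminus[of f G]
    by (intro bexI[of _ "\<lambda>x\<in>carrier G. - f x"]) (auto simp: L2_group_def)
  show "\<one>\<^bsub>L2_group G\<^esub> \<otimes>\<^bsub>L2_group G\<^esub> f = f"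
    using f by (auto simp: L2_group_def L2_def extensional_def)
next
  show "\<one>\<^bsub>L2_group G\<^esub> \<in> carrier (L2_group G)"
    by (simp add: L2_group_def L2_def cong: summable_on_cong)
qed (auto simp: L2_group_def L2_add add.assoc add.commute)

lemma left_regular_in_L2:
  fixes G (structure)
  assumes "group G" "g \<in> carrier G" "f \<in> L2 G"
  shows "left_regular G g f \<in> L2 G"
proof -
  interpret group G by fact
  have "bij_betw (\<lambda>h. inv g \<otimes> h) (carrier G) (carrier G)"
    by (rule bij_betw_byWitness[where f' = "\<lambda>h. g \<otimes> h"])
       (use assms(2) in \<open>auto simp: m_assoc[symmetric]\<close>)
  from summable_on_reindex_bij_betw[OF this, of "\<lambda>x. (f x)\<^sup>2"] assms(3) show ?thesis
    by (simp add: L2_def left_regular_def cong: summable_on_cong)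
qed

end

(* Let S be a finite generating set and D the operator f |-> sum_{s in S} (f - lambda_s f).

   If there are no almost invariant vectors in L^2, then 1 - t D is a strict contraction for small
   t > 0, so a Neumann series (which converges pointwise, making completeness of L^2 unnecessary)
   shows that D is onto; an invariant homomorphism kills the range of D, hence vanishes. If there
   are almost invariant vectors v, the densities v^2 / |v|^2 accumulate, by compactness of
   [0,1]^{subsets of G}, at an invariant mean.

   Conversely, if G is amenable it has Folner sets: otherwise |K F| >= 2 |F| for a fixed finite K
   and all finite F, and Hall's theorem gives an injection G x {0,1} -> G moving each point by an
   element of K, a paradoxical decomposition contradicting
   the invariant measure. Superposing normalised indicators of rapidly improving Folner sets gives
   an element of L^2 outside the subspace {sum_s (f_s - lambda_s f_s)}, and a linear functional
   vanishing on that subspace but not on this element yields the homomorphism. *)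
theory Submission
  imports Defs "HOL-Analysis.L2_Norm" "HOL-Analysis.Convex" "HOL-Analysis.Function_Topology"
    "HOL-Library.Function_Algebras"
begin

section \<open>Hall's theorem for infinite families of finite sets\<close>

(* Rado's argument: in a minimal family satisfying Hall's condition every member is a singleton.
   Here M collects the removed incidences, so minimal families correspond to maximal M. *)
lemma hall_marriage:
  fixes A :: "'i \<Rightarrow> 'b set"
  assumes fin: "\<And>i. i \<in> I \<Longrightarrow> finite (A i)"
    and hall: "\<And>J. finite J \<Longrightarrow> J \<subseteq> I \<Longrightarrow> card J \<le> card (\<Union>(A ` J))"
  shows "\<exists>c. inj_on c I \<and> (\<forall>i\<in>I. c i \<in> A i)"
proof -
  \<comment> \<open>\<open>B R i\<close> is what remains of \<open>A i\<close> after the incidences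
    in \<open>R\<close> are deleted; \<open>P\<close> collects the deletions that preserve Hall's
    condition.\<close>
  define B where "B R i = A i - R `` {i}" for R :: "('i \<times> 'b) set" and i
  define P where "P = {R. \<forall>J. finite J \<longrightarrow> J \<subseteq> I \<longrightarrow> card J \<le> card (\<Union>(B R ` J))}"
  have finB: "finite (B R i)" if "i \<in> I" for R i
    using fin[OF that] by (simp add: B_def)
  \<comment> \<open>Hall's condition for a finite \<open>J\<close> involves only the finitely many
    incidences in \<open>Sigma J A\<close>. Those deleted by the union of a nonempty chain are
    already deleted by one member of it, and that member satisfies the condition.\<close>
  have "\<Union>C \<in> P" if C: "C \<in> chains P" for C
  proof (cases "C = {}")
    case True
    then show ?thesis using hall by (simp add: P_def B_def)
  next
    case False
    have "card J \<le> card (\<Union>(B (\<Union>C) ` J))" if J: "finite J" "J \<subseteq> I" for J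
    proof -
      have "finite (\<Union>C \<inter> Sigma J A)"
        using J fin by (intro finite_Int disjI2 finite_SigmaI) auto
      moreover have "subset.chain P C"
        using C by (simp add: chains_alt_def)
      ultimately obtain R where R: "R \<in> C" "\<Union>C \<inter> Sigma J A \<subseteq> R"
        using finite_subset_Union_chain[of "\<Union>C \<inter> Sigma J A" C P] False by blast
      have "B (\<Union>C) i = B R i" if "i \<in> J" for i
        using R that by (auto simp: B_def)
      moreover have "R \<in> P"
        using C R by (auto simp: chains_def)
      ultimately show ?thesis
        using J by (simp add: P_def)
    qed
    then show ?thesis by (simp add: P_def)
  qed
  then obtain M where M: "M \<in> P" and max: "\<And>R. R \<in> P \<Longrightarrow> M \<subseteq> R \<Longrightarrow> R = M"
    using Zorn_Lemma[of P] by blast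
  have hallM: "card J \<le> card (\<Union>(B M ` J))" if "finite J" "J \<subseteq> I" for J
    using M that by (simp add: P_def)
  \<comment> \<open>By maximality of \<open>M\<close>, deleting \<open>x\<close> from
    \<open>B M i\<close> violates Hall's condition at some finite set. It must contain
    \<open>i\<close>; taking \<open>i\<close> out turns the strict inequality into
    \<open>\<le>\<close>.\<close>
  have critical: "\<exists>J. finite J \<and> J \<subseteq> I \<and> i \<notin> J \<and> card (\<Union>(B M ` J) \<union> (B M i - {x})) \<le> card J"
    if i: "i \<in> I" and x: "x \<in> B M i" for i x
  proof -
    have "insert (i, x) M \<notin> P"
      using max[of "insert (i, x) M"] x by (auto simp: B_def)
    then obtain J where J: "finite J" "J \<subseteq> I" "card (\<Union>(B (insert (i, x) M) ` J)) < card J"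
      by (auto simp: P_def not_le)
    have same: "B (insert (i, x) M) j = B M j" if "j \<noteq> i" for j
      using that by (auto simp: B_def)
    have at_i: "B (insert (i, x) M) i = B M i - {x}"
      by (auto simp: B_def)
    have "i \<in> J"
    proof (rule ccontr)
      assume "i \<notin> J"
      then have "B (insert (i, x) M) j = B M j" if "j \<in> J" for j
        using same[of j] that by metis
      then have "\<Union>(B (insert (i, x) M) ` J) = \<Union>(B M ` J)"
        by simp
      then show False using hallM[OF J(1,2)] J(3) by simp
    qed
    have "B (insert (i, x) M) ` (J - {i}) = B M ` (J - {i})"
      by (intro image_cong refl same) simp
    moreover have "\<Union>(B (insert (i, x) M) ` J) =
        \<Union>(B (insert (i, x) M) ` (J - {i})) \<union> B (insert (i, x) M) i"
      using \<open>i \<in> J\<close> by blast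
    ultimately have "\<Union>(B (insert (i, x) M) ` J) = \<Union>(B M ` (J - {i})) \<union> (B M i - {x})"
      by (simp add: at_i)
    moreover have "card J = Suc (card (J - {i}))"
      using card.remove[OF J(1) \<open>i \<in> J\<close>] .
    ultimately show ?thesis
      using J by (intro exI[of _ "J - {i}"]) auto
  qed
  have single: "x = y" if i: "i \<in> I" and x: "x \<in> B M i" and y: "y \<in> B M i" for i x y
  proof (rule ccontr)
    assume "x \<noteq> y"
    obtain J1 where J1: "finite J1" "J1 \<subseteq> I" "i \<notin> J1"
      "card (\<Union>(B M ` J1) \<union> (B M i - {x})) \<le> card J1"
      using critical[OF i x] by blast
    obtain J2 where J2: "finite J2" "J2 \<subseteq> I" "i \<notin> J2"
      "card (\<Union>(B M ` J2) \<union> (B M i - {y})) \<le> card J2"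
      using critical[OF i y] by blast
    \<comment> \<open>Submodularity: as \<open>x \<noteq> y\<close>, the union
      \<open>?X \<union> ?Y\<close> contains all of \<open>B M i\<close>, so it serves
      \<open>insert i (J1 \<union> J2)\<close>, while \<open>?X \<inter> ?Y\<close> serves
      \<open>J1 \<inter> J2\<close>. Adding the two Hall inequalities gives |?X| + |?Y| > |J1| +
      |J2|, against the choice of \<open>J1\<close> and \<open>J2\<close>.\<close>
    let ?X = "\<Union>(B M ` J1) \<union> (B M i - {x})" and ?Y = "\<Union>(B M ` J2) \<union> (B M i - {y})"
    have fins: "finite ?X" "finite ?Y"
      using J1 J2 i by (auto intro!: finB)
    have "card (insert i (J1 \<union> J2)) \<le> card (\<Union>(B M ` insert i (J1 \<union> J2)))"
      using J1 J2 i by (intro hallM) auto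
    also have "\<dots> \<le> card (?X \<union> ?Y)"
      using \<open>x \<noteq> y\<close> fins by (intro card_mono) auto
    finally have 1: "Suc (card (J1 \<union> J2)) \<le> card (?X \<union> ?Y)"
      using J1 J2 by simp
    have "card (J1 \<inter> J2) \<le> card (\<Union>(B M ` (J1 \<inter> J2)))"
      using J1 J2 by (intro hallM) auto
    also have "\<dots> \<le> card (?X \<inter> ?Y)"
      using fins by (intro card_mono) auto
    finally have 2: "card (J1 \<inter> J2) \<le> card (?X \<inter> ?Y)" .
    show False
      using 1 2 J1(4) J2(4) card_Un_Int[OF fins] card_Un_Int[OF J1(1) J2(1)] by linarith
  qed
  have "B M i \<noteq> {}" if "i \<in> I" for i
    using hallM[of "{i}"] that by auto
  then have ex: "\<forall>i\<in>I. \<exists>x. x \<in> B M i" by auto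
  then obtain c where c: "\<And>i. i \<in> I \<Longrightarrow> c i \<in> B M i"
    by metis
  have "inj_on c I"
  proof (rule inj_onI, rule ccontr)
    fix i j assume ij: "i \<in> I" "j \<in> I" "c i = c j" "i \<noteq> j"
    have "card {i, j} \<le> card (\<Union>(B M ` {i, j}))"
      using ij by (intro hallM) auto
    also have "\<dots> \<le> card {c i}"
      using single[OF ij(1) _ c[OF ij(1)]] single[OF ij(2) _ c[OF ij(2)]] ij(3)
      by (intro card_mono) auto
    finally show False using ij(4) by simp
  qed
  then show ?thesis using c by (auto simp: B_def intro!: exI[of _ c])
qed

section \<open>Square-summable functions and the Laplacian\<close>

text \<open>Membership in \<open>L2\<close> stripped of the \<open>extensional\<close> requirement,
  so that pointwise expressions can be used as they stand; \<open>L2_iff\<close> translates between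
  the two.\<close>

definition sq_summable :: "'a set \<Rightarrow> ('a \<Rightarrow> real) \<Rightarrow> bool" where
  "sq_summable A f \<longleftrightarrow> (\<lambda>x. (f x)\<^sup>2) summable_on A"

definition sqnorm :: "'a set \<Rightarrow> ('a \<Rightarrow> real) \<Rightarrow> real" where
  "sqnorm A f = (\<Sum>\<^sub>\<infinity>x\<in>A. (f x)\<^sup>2)"

lemma sqnorm_nonneg: "0 \<le> sqnorm A f"
  unfolding sqnorm_def by (rule infsum_nonneg) simp

lemma sq_summable_cong:
  assumes "\<And>x. x \<in> A \<Longrightarrow> f x = g x"
  shows "sq_summable A f \<longleftrightarrow> sq_summable A g"
  using assms unfolding sq_summable_def by (intro summable_on_cong) simp

lemma sq_summable_bounded_L2_set:
  assumes "\<And>F. finite F \<Longrightarrow> F \<subseteq> A \<Longrightarrow> L2_set f F \<le> C"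
  shows "sq_summable A f"
proof -
  have "(\<Sum>x\<in>F. (f x)\<^sup>2) \<le> C\<^sup>2" if "finite F" "F \<subseteq> A" for F
    using assms[OF that] by (simp add: L2_set_def sqrt_le_D)
  then show ?thesis
    unfolding sq_summable_def by (intro nonneg_bdd_above_summable_on) (auto intro!: bdd_aboveI2)
qed

lemma L2_set_le_sqnorm:
  assumes "sq_summable A f" "finite F" "F \<subseteq> A"
  shows "L2_set f F \<le> sqrt (sqnorm A f)"
  using assms unfolding L2_set_def sqnorm_def sq_summable_def
  by (intro real_sqrt_le_mono finite_sum_le_infsum) auto

lemma sq_summable_0: "sq_summable A (\<lambda>x. 0)"
  by (simp add: sq_summable_def)

lemma sq_summable_add:
  assumes "sq_summable A f" "sq_summable A g"
  shows "sq_summable A (\<lambda>x. f x + g x)"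
proof -
  have "(\<lambda>x. 2 * (f x)\<^sup>2 + 2 * (g x)\<^sup>2) summable_on A"
    using assms by (intro summable_on_add summable_on_cmult_right) (auto simp: sq_summable_def)
  moreover have "(f x + g x)\<^sup>2 \<le> 2 * (f x)\<^sup>2 + 2 * (g x)\<^sup>2" for x
    using sum_squares_bound[of "f x" "g x"] by (simp add: power2_sum)
  ultimately show ?thesis
    unfolding sq_summable_def by (rule summable_on_comparison_test) auto
qed

lemma sq_summable_cmult:
  assumes "sq_summable A f"
  shows "sq_summable A (\<lambda>x. c * f x)"
  using assms by (simp add: sq_summable_def power_mult_distrib summable_on_cmult_right)

lemma sq_summable_diff:
  assumes "sq_summable A f" "sq_summable A g"
  shows "sq_summable A (\<lambda>x. f x - g x)"
  using sq_summable_add[OF assms(1) sq_summable_cmult[OF assms(2), of "-1"]] by simp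

lemma sq_summable_sum:
  assumes "\<And>s. s \<in> S \<Longrightarrow> sq_summable A (f s)"
  shows "sq_summable A (\<lambda>x. \<Sum>s\<in>S. f s x)"
  using assms by (induction S rule: infinite_finite_induct) (auto simp: sq_summable_0 sq_summable_add)

lemma sq_summable_bij:
  assumes "bij_betw \<sigma> A A" "sq_summable A f"
  shows "sq_summable A (\<lambda>x. f (\<sigma> x))"
  using summable_on_reindex_bij_betw[OF assms(1), of "\<lambda>x. (f x)\<^sup>2"] assms(2)
  by (simp add: sq_summable_def)

lemma sqnorm_bij:
  assumes "bij_betw \<sigma> A A"
  shows "sqnorm A (\<lambda>x. f (\<sigma> x)) = sqnorm A f"
  using infsum_reindex_bij_betw[OF assms(1), of "\<lambda>x. (f x)\<^sup>2"] by (simp add: sqnorm_def)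

text \<open>A Weierstrass M-test in the l2 norm. On a finite set Minkowski's inequality bounds all
  partial sums by \<open>suminf a\<close>; this survives the pointwise limit, and a uniform bound
  over finite sets gives square-summability.\<close>

lemma sq_summable_suminf:
  assumes bound: "\<And>n F. finite F \<Longrightarrow> F \<subseteq> A \<Longrightarrow> L2_set (u n) F \<le> a n" and "summable a"
  shows "x \<in> A \<Longrightarrow> summable (\<lambda>n. u n x)"
    and "sq_summable A (\<lambda>x. suminf (\<lambda>n. u n x))"
proof -
  show sm: "summable (\<lambda>n. u n x)" if "x \<in> A" for x
  proof (rule summable_comparison_test'[OF \<open>summable a\<close>])
    show "norm (u n x) \<le> a n" for n
      using bound[of "{x}" n] that by simp
  qed
  have a0: "0 \<le> a n" for n
    using bound[of "{}" n] by simp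
  show "sq_summable A (\<lambda>x. suminf (\<lambda>n. u n x))"
  proof (rule sq_summable_bounded_L2_set)
    fix F assume F: "finite F" "F \<subseteq> A"
    have "L2_set (\<lambda>x. \<Sum>n<N. u n x) F \<le> (\<Sum>n<N. a n)" for N
    proof (induction N)
      case (Suc N)
      then show ?case
        using L2_set_triangle_ineq[of "\<lambda>x. \<Sum>n<N. u n x" "u N" F] bound[OF F, of N] by simp
    qed (simp add: L2_set_def)
    then have "L2_set (\<lambda>x. \<Sum>n<N. u n x) F \<le> suminf a" for N
      using sum_le_suminf[OF \<open>summable a\<close>, of "{..<N}"] a0 by (meson finite_lessThan order_trans)
    moreover have "(\<lambda>N. L2_set (\<lambda>x. \<Sum>n<N. u n x) F) \<longlonglongrightarrow> L2_set (\<lambda>x. suminf (\<lambda>n. u n x)) F"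
      unfolding L2_set_def using F sm
      by (intro tendsto_intros summable_LIMSEQ) auto
    ultimately show "L2_set (\<lambda>x. suminf (\<lambda>n. u n x)) F \<le> suminf a"
      by (intro LIMSEQ_le_const2) auto
  qed
qed

section \<open>The Laplacian: contraction estimate and Neumann series\<close>

lemma has_sum_sum:
  fixes f :: "'s \<Rightarrow> 'a \<Rightarrow> real"
  assumes "\<And>s. s \<in> S \<Longrightarrow> (f s has_sum c s) A"
  shows "((\<lambda>x. \<Sum>s\<in>S. f s x) has_sum (\<Sum>s\<in>S. c s)) A"
  using assms
  by (induction S rule: infinite_finite_induct) (auto intro: has_sum_add has_sum_0)

text \<open>Formulated for any family of self-maps; in the group case \<open>\<sigma> s x\<close> is
  \<open>inv s \<otimes> x\<close>, so that \<open>f (\<sigma> s x)\<close> is the value of lambda_s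
  f at \<open>x\<close>.\<close>

definition laplacian :: "'s set \<Rightarrow> ('s \<Rightarrow> 'a \<Rightarrow> 'a) \<Rightarrow> ('a \<Rightarrow> real) \<Rightarrow> 'a \<Rightarrow> real" where
  "laplacian S \<sigma> f x = (\<Sum>s\<in>S. f x - f (\<sigma> s x))"

lemma sq_summable_laplacian:
  assumes "\<And>s. s \<in> S \<Longrightarrow> bij_betw (\<sigma> s) A A" "sq_summable A f"
  shows "sq_summable A (laplacian S \<sigma> f)"
  unfolding laplacian_def
  by (rule sq_summable_sum, rule sq_summable_diff[OF assms(2) sq_summable_bij[OF assms]])

(* For a permutation operator U one has 2 <f - U f, f> = |f - U f|^2, so no self-adjointness of
   the Laplacian is needed. *)
lemma sqnorm_laplacian_step:
  assumes bij: "\<And>s. s \<in> S \<Longrightarrow> bij_betw (\<sigma> s) A A" and f: "sq_summable A f" and "0 \<le> t"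
  shows "sqnorm A (\<lambda>x. f x - t * laplacian S \<sigma> f x) \<le>
    sqnorm A f - t * (1 - t * card S) * (\<Sum>s\<in>S. sqnorm A (\<lambda>x. f x - f (\<sigma> s x)))"
proof -
  let ?d = "\<lambda>s x. f x - f (\<sigma> s x)"
  have sq: "(\<lambda>x. (f x)\<^sup>2) summable_on A" "\<And>s. s \<in> S \<Longrightarrow> (\<lambda>x. (?d s x)\<^sup>2) summable_on A"
    "\<And>s. s \<in> S \<Longrightarrow> (\<lambda>x. (f (\<sigma> s x))\<^sup>2) summable_on A"
    using f sq_summable_bij[OF bij f] sq_summable_diff[OF f sq_summable_bij[OF bij f]]
    unfolding sq_summable_def by blast+
  \<comment> \<open>The quadratic term in \<open>t\<close> is bounded by Cauchy-Schwarz over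
    \<open>S\<close>. The linear term is rewritten by 2 a (a - b) = (a - b)^2 + a^2 - b^2 with a =
    f(x) and b = f(sigma_s x).\<close>
  have pointwise: "(f x - t * laplacian S \<sigma> f x)\<^sup>2 \<le>
      (f x)\<^sup>2 + (\<Sum>s\<in>S. (t\<^sup>2 * card S - t) * (?d s x)\<^sup>2 + (t * (f (\<sigma> s x))\<^sup>2 - t * (f x)\<^sup>2))" for x
  proof -
    have "(laplacian S \<sigma> f x)\<^sup>2 \<le> card S * (\<Sum>s\<in>S. (?d s x)\<^sup>2)"
      using sum_squared_le_sum_of_squares[of "\<lambda>s. ?d s x" S] by (simp add: laplacian_def mult.commute)
    then have "t\<^sup>2 * (laplacian S \<sigma> f x)\<^sup>2 \<le> t\<^sup>2 * (card S * (\<Sum>s\<in>S. (?d s x)\<^sup>2))"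
      by (rule mult_left_mono) simp
    also have "\<dots> = (\<Sum>s\<in>S. t\<^sup>2 * card S * (?d s x)\<^sup>2)"
      by (simp add: sum_distrib_left mult.assoc)
    finally have 1: "t\<^sup>2 * (laplacian S \<sigma> f x)\<^sup>2 \<le> (\<Sum>s\<in>S. t\<^sup>2 * card S * (?d s x)\<^sup>2)" .
    have 2: "- (2 * t * (f x * laplacian S \<sigma> f x)) =
        (\<Sum>s\<in>S. - t * (?d s x)\<^sup>2 + (t * (f (\<sigma> s x))\<^sup>2 - t * (f x)\<^sup>2))"
      unfolding laplacian_def sum_distrib_left sum_negf[symmetric]
      by (rule sum.cong[OF refl]) (simp add: power2_eq_square algebra_simps)
    have "(f x - t * laplacian S \<sigma> f x)\<^sup>2 =
        (f x)\<^sup>2 + - (2 * t * (f x * laplacian S \<sigma> f x)) + t\<^sup>2 * (laplacian S \<sigma> f x)\<^sup>2"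
      by (simp add: power2_eq_square algebra_simps)
    also have "\<dots> \<le> (f x)\<^sup>2 + (\<Sum>s\<in>S. - t * (?d s x)\<^sup>2 + (t * (f (\<sigma> s x))\<^sup>2 - t * (f x)\<^sup>2)) +
        (\<Sum>s\<in>S. t\<^sup>2 * card S * (?d s x)\<^sup>2)"
      unfolding 2 using 1 by simp
    also have "\<dots> = (f x)\<^sup>2 +
        (\<Sum>s\<in>S. (t\<^sup>2 * card S - t) * (?d s x)\<^sup>2 + (t * (f (\<sigma> s x))\<^sup>2 - t * (f x)\<^sup>2))"
      unfolding add.assoc sum.distrib[symmetric]
      by (rule arg_cong[where f = "\<lambda>z. (f x)\<^sup>2 + z"], rule sum.cong[OF refl])
        (simp add: left_diff_distrib)
    finally show ?thesis .
  qed
  \<comment> \<open>Since \<open>\<sigma> s\<close> permutes \<open>A\<close>, the differences of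
    squares of \<open>f (\<sigma> s x)\<close> and \<open>f x\<close> sum to zero, leaving only the
    multiple of |f - U_s f|^2.\<close>
  have hs: "((\<lambda>x. (t\<^sup>2 * card S - t) * (?d s x)\<^sup>2 + (t * (f (\<sigma> s x))\<^sup>2 - t * (f x)\<^sup>2))
      has_sum (t\<^sup>2 * card S - t) * sqnorm A (?d s)) A" if s: "s \<in> S" for s
  proof -
    have "((\<lambda>x. (t\<^sup>2 * card S - t) * (?d s x)\<^sup>2 + (t * (f (\<sigma> s x))\<^sup>2 + (- t) * (f x)\<^sup>2))
      has_sum (t\<^sup>2 * card S - t) * sqnorm A (?d s) + (t * sqnorm A (\<lambda>x. f (\<sigma> s x)) + (- t) * sqnorm A f)) A"
      unfolding sqnorm_def
      by (rule has_sum_add[OF _ has_sum_add]; rule has_sum_cmult_right; rule has_sum_infsum)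
        (rule sq | rule s)+
    then show ?thesis by (simp add: sqnorm_bij[OF bij[OF s], of f])
  qed
  have big: "((\<lambda>x. (f x)\<^sup>2 + (\<Sum>s\<in>S. (t\<^sup>2 * card S - t) * (?d s x)\<^sup>2 + (t * (f (\<sigma> s x))\<^sup>2 - t * (f x)\<^sup>2)))
      has_sum sqnorm A f + (\<Sum>s\<in>S. (t\<^sup>2 * card S - t) * sqnorm A (?d s))) A"
    unfolding sqnorm_def[of A f]
    by (rule has_sum_add[OF has_sum_infsum[OF sq(1)] has_sum_sum[OF hs]])
  have small: "((\<lambda>x. (f x - t * laplacian S \<sigma> f x)\<^sup>2)
      has_sum sqnorm A (\<lambda>x. f x - t * laplacian S \<sigma> f x)) A"
    using sq_summable_diff[OF f sq_summable_cmult[OF sq_summable_laplacian[OF bij f], where c = t]]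
    unfolding sqnorm_def sq_summable_def by (rule has_sum_infsum)
  have "sqnorm A (\<lambda>x. f x - t * laplacian S \<sigma> f x) \<le>
      sqnorm A f + (\<Sum>s\<in>S. (t\<^sup>2 * card S - t) * sqnorm A (?d s))"
    using has_sum_mono[OF small big pointwise] .
  also have "(\<Sum>s\<in>S. (t\<^sup>2 * card S - t) * sqnorm A (?d s)) = (t\<^sup>2 * card S - t) * (\<Sum>s\<in>S. sqnorm A (?d s))"
    by (rule sum_distrib_left[symmetric])
  also have "t\<^sup>2 * card S - t = - (t * (1 - t * card S))"
    by (simp add: power2_eq_square algebra_simps)
  finally show ?thesis by simp
qed

text \<open>The gap makes \<open>T = 1 - t D\<close> contract the norm by a factor
  \<open>q < 1\<close>, so the iterates \<open>u n\<close> of \<open>f\<close> decay geometrically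
  and \<open>h = t * (u 0 + u 1 + ...)\<close> inverts \<open>D\<close>.\<close>

lemma laplacian_surj:
  fixes A :: "'a set"
  assumes "finite S" and bij: "\<And>s. s \<in> S \<Longrightarrow> bij_betw (\<sigma> s) A A" and "0 < \<epsilon>"
    and gap: "\<And>f. sq_summable A f \<Longrightarrow> \<epsilon> * sqnorm A f \<le> (\<Sum>s\<in>S. sqnorm A (\<lambda>x. f x - f (\<sigma> s x)))"
    and f: "sq_summable A f"
  shows "\<exists>h. sq_summable A h \<and> (\<forall>x\<in>A. laplacian S \<sigma> h x = f x)"
proof -
  \<comment> \<open>This \<open>t\<close> makes \<open>1 - t * card S\<close> at least 1/2, also for
    empty \<open>S\<close>. Capping the gap at 1 gives \<open>t * e \<le> 1/2\<close>, which keeps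
    the radicand of \<open>q\<close> positive.\<close>
  define t where "t = 1 / (2 * (real (card S) + 1))"
  define e where "e = min \<epsilon> 1"
  have t: "0 < t" "t \<le> 1 / 2" "t * card S \<le> 1 / 2"
    by (auto simp: t_def field_simps)
  have e: "0 < e" "e \<le> 1" using \<open>0 < \<epsilon>\<close> by (auto simp: e_def)
  define q where "q = sqrt (1 - t * e / 2)"
  have te: "t * e \<le> 1/2 * 1" using t e by (intro mult_mono) auto
  have q: "0 \<le> q" "q < 1" using t e te by (auto simp: q_def)
  define T where "T f = (\<lambda>x. f x - t * laplacian S \<sigma> f x)" for f :: "'a \<Rightarrow> real"
  have T_sq: "sq_summable A (T f)" if "sq_summable A f" for f
    unfolding T_def by (rule sq_summable_diff[OF that sq_summable_cmult[OF sq_summable_laplacian[OF bij that]]])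
  have T_norm: "sqrt (sqnorm A (T f)) \<le> q * sqrt (sqnorm A f)" if "sq_summable A f" for f
  proof -
    let ?D = "\<Sum>s\<in>S. sqnorm A (\<lambda>x. f x - f (\<sigma> s x))"
    have "sqnorm A (T f) \<le> sqnorm A f - t * (1 - t * card S) * ?D"
      unfolding T_def using that t by (intro sqnorm_laplacian_step bij) auto
    also have "\<dots> \<le> sqnorm A f - t * (1 / 2) * ?D"
    proof -
      have "t * (1 / 2) * ?D \<le> t * (1 - t * card S) * ?D"
        using t by (intro mult_right_mono mult_left_mono sum_nonneg sqnorm_nonneg) auto
      then show ?thesis by simp
    qed
    also have "\<dots> \<le> sqnorm A f - t * (1 / 2) * (e * sqnorm A f)"
    proof -
      have "e * sqnorm A f \<le> \<epsilon> * sqnorm A f"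
        using sqnorm_nonneg[of A f] by (intro mult_right_mono) (auto simp: e_def)
      then have "e * sqnorm A f \<le> ?D" using gap[OF that] by simp
      then show ?thesis using t by simp
    qed
    also have "\<dots> = (1 - t * e / 2) * sqnorm A f"
      by (simp add: algebra_simps)
    finally have "sqrt (sqnorm A (T f)) \<le> sqrt ((1 - t * e / 2) * sqnorm A f)"
      by simp
    then show ?thesis by (simp add: q_def real_sqrt_mult)
  qed
  define u where "u n = (T ^^ n) f" for n
  have u_Suc: "u (Suc n) x = u n x - t * laplacian S \<sigma> (u n) x" for n x
    by (simp add: u_def T_def)
  have u: "sq_summable A (u n) \<and> sqrt (sqnorm A (u n)) \<le> q ^ n * sqrt (sqnorm A f)" for n
  proof (induction n)
    case (Suc n)
    have "sqrt (sqnorm A (u (Suc n))) \<le> q * sqrt (sqnorm A (u n))"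
      using T_norm Suc by (simp add: u_def)
    also have "\<dots> \<le> q * (q ^ n * sqrt (sqnorm A f))"
      using Suc q by (intro mult_left_mono) auto
    finally show ?case using Suc T_sq by (simp add: u_def mult.assoc)
  qed (simp add: u_def f)
  have bound: "L2_set (u n) F \<le> q ^ n * sqrt (sqnorm A f)" if "finite F" "F \<subseteq> A" for n F
    using L2_set_le_sqnorm[OF conjunct1[OF u] that, of n] u[of n] by linarith
  have geo: "summable (\<lambda>n. q ^ n * sqrt (sqnorm A f))"
    using q by (intro summable_mult2 summable_geometric) auto
  have sm: "summable (\<lambda>n. u n x)" if "x \<in> A" for x
    using sq_summable_suminf(1)[OF bound geo that] .
  define h where "h x = t * suminf (\<lambda>n. u n x)" for x
  have "laplacian S \<sigma> h x = f x" if x: "x \<in> A" for x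
  proof -
    have \<sigma>x: "\<sigma> s x \<in> A" if "s \<in> S" for s
      using bij[OF that] x by (auto simp: bij_betw_def)
    have "laplacian S \<sigma> h x = (\<Sum>s\<in>S. suminf (\<lambda>n. t * (u n x - u n (\<sigma> s x))))"
      unfolding laplacian_def h_def right_diff_distrib[symmetric]
      using x \<sigma>x sm by (intro sum.cong refl) (simp add: suminf_diff suminf_mult summable_diff)
    also have "\<dots> = suminf (\<lambda>n. \<Sum>s\<in>S. t * (u n x - u n (\<sigma> s x)))"
      using x \<sigma>x sm by (intro suminf_sum[symmetric] summable_mult summable_diff) auto
    \<comment> \<open>By the recursion, \<open>t\<close> times the Laplacian of \<open>u n\<close>
      is \<open>u n - u (Suc n)\<close>. The series telescopes to \<open>u 0 = f\<close>, because
      the terms of a convergent series tend to zero.\<close>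
    also have "\<dots> = suminf (\<lambda>n. u n x - u (Suc n) x)"
      by (simp add: u_Suc laplacian_def sum_distrib_left)
    also have "\<dots> = u 0 x"
      using telescope_sums'[OF summable_LIMSEQ_zero[OF sm[OF x]]] by (simp add: sums_iff)
    finally show ?thesis by (simp add: u_def)
  qed
  moreover have "sq_summable A h"
    unfolding h_def by (intro sq_summable_cmult sq_summable_suminf(2)[OF bound geo])
  ultimately show ?thesis by blast
qed

section \<open>Comparing squared norms on subsets\<close>

lemma sq_summable_subset: "sq_summable B f \<Longrightarrow> A \<subseteq> B \<Longrightarrow> sq_summable A f"
  unfolding sq_summable_def by (rule summable_on_subset_banach)

lemma sqnorm_mono_set:
  assumes "sq_summable B f" "A \<subseteq> B"
  shows "sqnorm A f \<le> sqnorm B f"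
  using assms(1) sq_summable_subset[OF assms] unfolding sqnorm_def sq_summable_def
  by (intro infsum_mono2 assms(2)) simp_all

(* AM-GM applied to f^2 - g^2 = (f - g) (f + g) *)
lemma sqnorm_diff_le:
  assumes f: "sq_summable A f" and g: "sq_summable A g" and "0 < c"
  shows "sqnorm A f - sqnorm A g \<le> sqnorm A (\<lambda>x. f x - g x) / (2 * c) + c * (sqnorm A f + sqnorm A g)"
proof -
  have pointwise: "(f x)\<^sup>2 \<le> (g x)\<^sup>2 + ((1 / (2 * c)) * (f x - g x)\<^sup>2 + c * ((f x)\<^sup>2 + (g x)\<^sup>2))" for x
  proof -
    \<comment> \<open>The second square is added so that, by the parallelogram law, c^2 (f + g)^2
      becomes 2 c^2 (f^2 + g^2).\<close>
    have "0 \<le> (f x - g x - c * (f x + g x))\<^sup>2 + c\<^sup>2 * (f x - g x)\<^sup>2"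
      by simp
    also have "\<dots> = (f x - g x)\<^sup>2 + 2 * c * (c * ((f x)\<^sup>2 + (g x)\<^sup>2)) - 2 * c * ((f x)\<^sup>2 - (g x)\<^sup>2)"
      by (simp add: power2_eq_square algebra_simps)
    finally have "2 * c * ((f x)\<^sup>2 - (g x)\<^sup>2) \<le> (f x - g x)\<^sup>2 + 2 * c * (c * ((f x)\<^sup>2 + (g x)\<^sup>2))"
      by simp
    then have "(f x)\<^sup>2 - (g x)\<^sup>2 \<le> ((f x - g x)\<^sup>2 + 2 * c * (c * ((f x)\<^sup>2 + (g x)\<^sup>2))) / (2 * c)"
      using \<open>0 < c\<close> by (simp add: pos_le_divide_eq mult.commute)
    also have "\<dots> = (1 / (2 * c)) * (f x - g x)\<^sup>2 + c * ((f x)\<^sup>2 + (g x)\<^sup>2)"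
      using \<open>0 < c\<close> by (simp add: add_divide_distrib)
    finally show ?thesis by simp
  qed
  have sq: "(\<lambda>x. (f x)\<^sup>2) summable_on A" "(\<lambda>x. (g x)\<^sup>2) summable_on A"
    "(\<lambda>x. (f x - g x)\<^sup>2) summable_on A"
    using f g sq_summable_diff[OF f g] by (auto simp: sq_summable_def)
  have "((\<lambda>x. (g x)\<^sup>2 + ((1 / (2 * c)) * (f x - g x)\<^sup>2 + c * ((f x)\<^sup>2 + (g x)\<^sup>2))) has_sum
      sqnorm A g + ((1 / (2 * c)) * sqnorm A (\<lambda>x. f x - g x) + c * (sqnorm A f + sqnorm A g))) A"
    unfolding sqnorm_def using sq by (intro has_sum_add has_sum_cmult_right has_sum_infsum)
  from has_sum_mono[OF has_sum_infsum[OF sq(1)] this pointwise]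
  show ?thesis by (simp add: sqnorm_def)
qed

lemma abs_sqnorm_diff_le:
  assumes f: "sq_summable A f" and g: "sq_summable A g" and "0 < c"
  shows "\<bar>sqnorm A f - sqnorm A g\<bar> \<le>
    sqnorm A (\<lambda>x. f x - g x) / (2 * c) + c * (sqnorm A f + sqnorm A g)"
proof -
  have "sqnorm A (\<lambda>x. f x - g x) = sqnorm A (\<lambda>x. g x - f x)"
    by (simp add: sqnorm_def power2_commute)
  then show ?thesis
    using sqnorm_diff_le[OF assms] sqnorm_diff_le[OF g f \<open>0 < c\<close>] by (simp add: abs_le_iff add.commute)
qed

section \<open>Almost invariant vectors\<close>

context group
begin

lemma bij_betw_translate:
  assumes "g \<in> carrier G"
  shows "bij_betw (\<lambda>h. g \<otimes> h) (carrier G) (carrier G)"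
  by (rule bij_betw_byWitness[where f' = "\<lambda>h. inv g \<otimes> h"])
    (use assms in \<open>auto simp: m_assoc[symmetric]\<close>)

text \<open>The mass of \<open>v\<close> on \<open>A\<close> is the mass of the translate lambda_s v
  on \<open>s <# A\<close>. Thus two functions are compared on one set, and each error term is
  enlarged to the whole group, where \<open>v\<close> and its translate have equal norm.\<close>

lemma abs_sqnorm_l_coset_diff_le:
  assumes v: "sq_summable (carrier G) v" and s: "s \<in> carrier G" and A: "A \<subseteq> carrier G" and "0 < c"
  shows "\<bar>sqnorm (s <# A) v - sqnorm A v\<bar> \<le>
    sqnorm (carrier G) (\<lambda>x. v x - v (inv s \<otimes> x)) / (2 * c) + 2 * c * sqnorm (carrier G) v"
proof -
  let ?w = "\<lambda>x. v (inv s \<otimes> x)"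
  have bij: "bij_betw (\<lambda>x. inv s \<otimes> x) (carrier G) (carrier G)"
    using s by (intro bij_betw_translate) simp
  have w: "sq_summable (carrier G) ?w"
    using sq_summable_bij[OF bij v] .
  have sA: "s <# A \<subseteq> carrier G"
    using s A by (auto simp: l_coset_def)
  have "bij_betw (\<lambda>x. inv s \<otimes> x) (s <# A) A"
    by (rule bij_betw_byWitness[where f' = "\<lambda>h. s \<otimes> h"])
      (use s A in \<open>auto simp: l_coset_def m_assoc[symmetric] subset_iff\<close>)
  then have "sqnorm A v = sqnorm (s <# A) ?w"
    unfolding sqnorm_def by (rule infsum_reindex_bij_betw[symmetric])
  then have "\<bar>sqnorm (s <# A) v - sqnorm A v\<bar> = \<bar>sqnorm (s <# A) v - sqnorm (s <# A) ?w\<bar>"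
    by simp
  also have "\<dots> \<le> sqnorm (s <# A) (\<lambda>x. v x - ?w x) / (2 * c) +
      c * (sqnorm (s <# A) v + sqnorm (s <# A) ?w)"
    using v w sA \<open>0 < c\<close> by (intro abs_sqnorm_diff_le) (auto intro: sq_summable_subset)
  also have "\<dots> \<le> sqnorm (carrier G) (\<lambda>x. v x - ?w x) / (2 * c) +
      c * (sqnorm (carrier G) v + sqnorm (carrier G) ?w)"
    using \<open>0 < c\<close> sqnorm_mono_set[OF v sA] sqnorm_mono_set[OF w sA]
      sqnorm_mono_set[OF sq_summable_diff[OF v w] sA]
    by (intro add_mono mult_left_mono divide_right_mono) auto
  also have "sqnorm (carrier G) ?w = sqnorm (carrier G) v"
    by (rule sqnorm_bij[OF bij])
  finally show ?thesis by simp
qed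

section \<open>From approximately invariant to invariant means\<close>

lemma measure_invariant_generate:
  fixes \<mu> :: "'a set \<Rightarrow> real"
  assumes S: "S \<subseteq> carrier G"
    and inv: "\<And>s A. s \<in> S \<Longrightarrow> A \<subseteq> carrier G \<Longrightarrow> \<mu> (s <# A) = \<mu> A"
    and "g \<in> generate G S" and A: "A \<subseteq> carrier G"
  shows "\<mu> (g <# A) = \<mu> A"
  using assms(3) A
proof (induction arbitrary: A rule: generate.induct)
  case one
  then show ?case by (simp add: lcos_mult_one)
next
  case (incl s)
  then show ?case by (rule inv)
next
  case (inv s)
  then have "s \<in> carrier G" using S by auto
  then have "inv s <# A \<subseteq> carrier G" using inv(2) l_coset_subset_G by simp
  \<comment> \<open>Invariance under \<open>inv s\<close> follows from invariance under
    \<open>s\<close>, applied to the translated set.\<close>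
  then have "\<mu> (s <# (inv s <# A)) = \<mu> (inv s <# A)"
    using assms(2) inv(1) by blast
  moreover have "s <# (inv s <# A) = A"
    using \<open>s \<in> carrier G\<close> inv(2) by (simp add: lcos_m_assoc lcos_mult_one)
  ultimately show ?case by simp
next
  case (eng g h)
  have gh: "g \<in> carrier G" "h \<in> carrier G"
    using eng.hyps generate_in_carrier[OF S] by auto
  then have "\<mu> (g <# (h <# A)) = \<mu> (h <# A)"
    by (intro eng.IH(1) l_coset_subset_G eng.prems)
  also have "\<dots> = \<mu> A" by (rule eng.IH(2)[OF eng.prems])
  finally show ?case using gh eng.prems by (simp add: lcos_m_assoc)
qed

text \<open>By Tychonoff the cube \<open>K\<close> of all [0,1]-valued set functions is compact. The
  sets \<open>C n\<close> of means that are 1/(n+1)-invariant under \<open>S\<close> are closed and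
  have the finite intersection property in \<open>K\<close>; a common point is exactly invariant
  under \<open>S\<close>, hence under the generated group.\<close>

lemma amenable_of_approx_means:
  assumes S: "S \<subseteq> carrier G" "generate G S = carrier G"
    and approx: "\<And>\<delta>. 0 < \<delta> \<Longrightarrow> \<exists>\<mu> :: 'a set \<Rightarrow> real.
      (\<forall>A. 0 \<le> \<mu> A \<and> \<mu> A \<le> 1) \<and> \<mu> (carrier G) = 1 \<and>
      (\<forall>A B. A \<subseteq> carrier G \<longrightarrow> B \<subseteq> carrier G \<longrightarrow> A \<inter> B = {} \<longrightarrow> \<mu> (A \<union> B) = \<mu> A + \<mu> B) \<and>
      (\<forall>s\<in>S. \<forall>A. A \<subseteq> carrier G \<longrightarrow> \<bar>\<mu> (s <# A) - \<mu> A\<bar> \<le> \<delta>)"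
  shows "amenable G"
proof -
  define K where "K = (UNIV \<rightarrow>\<^sub>E {0..1} :: ('a set \<Rightarrow> real) set)"
  define C where "C n = {\<mu> :: 'a set \<Rightarrow> real. \<mu> (carrier G) = 1 \<and>
      (\<forall>A B. A \<subseteq> carrier G \<longrightarrow> B \<subseteq> carrier G \<longrightarrow> A \<inter> B = {} \<longrightarrow> \<mu> (A \<union> B) = \<mu> A + \<mu> B) \<and>
      (\<forall>s. s \<in> S \<longrightarrow> (\<forall>A. A \<subseteq> carrier G \<longrightarrow> \<bar>\<mu> (s <# A) - \<mu> A\<bar> \<le> inverse (real (Suc n))))}" for n
  have "compact K"
    unfolding K_def compactin_euclidean_iff[symmetric] euclidean_product_topology[symmetric]
    by (subst compactin_PiE) (simp add: compactin_euclidean_iff)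
  moreover have "closed T" if T: "T \<in> range C" for T
  proof -
    obtain n where "T = C n" using T by auto
    \<comment> \<open>Each defining condition compares finitely many evaluations of
      \<open>\<mu>\<close>, which are continuous in the product topology.\<close>
    moreover have "closed (C n)"
      unfolding C_def
      by (intro closed_Collect_conj closed_Collect_all closed_Collect_imp open_Collect_const
          closed_Collect_eq closed_Collect_le continuous_intros continuous_on_product_coordinates)
    ultimately show ?thesis by simp
  qed
  moreover have "K \<inter> \<Inter>F' \<noteq> {}" if F': "finite F'" "F' \<subseteq> range C" for F'
  proof -
    obtain N where N: "finite N" "F' = C ` N"
      using F' by (meson finite_subset_image)
    \<comment> \<open>The \<open>C n\<close> decrease with \<open>n\<close>, so the largest index
      suffices; the inserted 0 covers an empty index set.\<close>
    let ?\<delta> = "inverse (real (Suc (Max (insert 0 N))))"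
    have "0 < ?\<delta>" by simp
    from approx[OF this] obtain \<mu> :: "'a set \<Rightarrow> real"
      where \<mu>01: "\<forall>A. 0 \<le> \<mu> A \<and> \<mu> A \<le> 1" and "\<mu> (carrier G) = 1"
        and "\<forall>A B. A \<subseteq> carrier G \<longrightarrow> B \<subseteq> carrier G \<longrightarrow> A \<inter> B = {} \<longrightarrow> \<mu> (A \<union> B) = \<mu> A + \<mu> B"
        and "\<forall>s\<in>S. \<forall>A. A \<subseteq> carrier G \<longrightarrow> \<bar>\<mu> (s <# A) - \<mu> A\<bar> \<le> ?\<delta>"
      by (elim exE conjE) (rule that)
    then have \<mu>: "\<mu> \<in> C (Max (insert 0 N))"
      unfolding C_def by blast
    have "\<mu> \<in> K"
      using \<mu>01 by (simp add: K_def PiE_UNIV_domain Pi_iff)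
    have "\<mu> \<in> C n" if "n \<in> N" for n
    proof -
      have "n \<le> Max (insert 0 N)"
        using N that by simp
      then have "inverse (real (Suc (Max (insert 0 N)))) \<le> inverse (real (Suc n))"
        by (intro le_imp_inverse_le) auto
      then show ?thesis
        using \<mu> unfolding C_def by (blast intro: order_trans)
    qed
    then show ?thesis using \<open>\<mu> \<in> K\<close> N by auto
  qed
  ultimately have "K \<inter> \<Inter>(range C) \<noteq> {}"
    by (rule compact_imp_fip)
  then obtain \<mu> where \<mu>K: "\<mu> \<in> K" and \<mu>C: "\<And>n. \<mu> \<in> C n" by blast
  have "\<mu> (s <# A) = \<mu> A" if "s \<in> S" "A \<subseteq> carrier G" for s A
  proof (rule ccontr)
    assume "\<mu> (s <# A) \<noteq> \<mu> A"
    then obtain n where "inverse (real (Suc n)) < \<bar>\<mu> (s <# A) - \<mu> A\<bar>"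
      using reals_Archimedean[of "\<bar>\<mu> (s <# A) - \<mu> A\<bar>"] by auto
    moreover have "\<bar>\<mu> (s <# A) - \<mu> A\<bar> \<le> inverse (real (Suc n))"
      using \<mu>C[of n] that unfolding C_def by blast
    ultimately show False by linarith
  qed
  then have inv: "\<mu> (g <# A) = \<mu> A" if "g \<in> carrier G" "A \<subseteq> carrier G" for g A
    using measure_invariant_generate[OF S(1), of \<mu> g A] that S(2) by blast
  have nonneg: "\<forall>A. 0 \<le> \<mu> A"
    using \<mu>K by (auto simp: K_def PiE_UNIV_domain Pi_iff)
  show ?thesis
    unfolding amenable_def
  proof (intro exI[of _ \<mu>] conjI ballI allI impI)
    show "\<mu> (carrier G) = 1"
      and "\<And>A B. A \<subseteq> carrier G \<Longrightarrow> B \<subseteq> carrier G \<Longrightarrow> A \<inter> B = {} \<Longrightarrow> \<mu> (A \<union> B) = \<mu> A + \<mu> B"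
      using \<mu>C[of 0] unfolding C_def by blast+
  qed (use inv nonneg in blast)+
qed

lemma amenable_of_almost_invariant_vectors:
  assumes S: "finite S" "S \<subseteq> carrier G" "generate G S = carrier G"
    and almost: "\<And>\<epsilon>. 0 < \<epsilon> \<Longrightarrow> \<exists>v. sq_summable (carrier G) v \<and>
      (\<Sum>s\<in>S. sqnorm (carrier G) (\<lambda>x. v x - v (inv s \<otimes> x))) < \<epsilon> * sqnorm (carrier G) v"
  shows "amenable G"
proof (rule amenable_of_approx_means[OF S(2,3)])
  fix \<delta> :: real assume "0 < \<delta>"
  \<comment> \<open>With the threshold \<open>\<epsilon> = 4 c^2\<close>, both error terms of
    \<open>abs_sqnorm_l_coset_diff_le\<close> are at most \<open>2 c\<close> times the squared norm
    of \<open>v\<close>, together \<open>\<delta>\<close> times it.\<close>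
  define c where "c = \<delta> / 4"
  have "0 < c" using \<open>0 < \<delta>\<close> by (simp add: c_def)
  obtain v where v: "sq_summable (carrier G) v"
    and inv_v: "(\<Sum>s\<in>S. sqnorm (carrier G) (\<lambda>x. v x - v (inv s \<otimes> x))) < 4 * c\<^sup>2 * sqnorm (carrier G) v"
    using almost[of "4 * c\<^sup>2"] \<open>0 < c\<close> by auto
  let ?N = "sqnorm (carrier G) v"
  have "0 \<le> (\<Sum>s\<in>S. sqnorm (carrier G) (\<lambda>x. v x - v (inv s \<otimes> x)))"
    by (intro sum_nonneg sqnorm_nonneg)
  then have "0 < 4 * c\<^sup>2 * ?N" using inv_v by linarith
  then have N: "0 < ?N" using \<open>0 < c\<close> by (simp add: zero_less_mult_iff)
  \<comment> \<open>Intersecting with the carrier keeps the values in [0,1] on every set of the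
    type, as membership in the compact cube demands.\<close>
  define \<mu> where "\<mu> A = sqnorm (A \<inter> carrier G) v / ?N" for A
  have \<mu>: "\<mu> A = sqnorm A v / ?N" if "A \<subseteq> carrier G" for A
    using that by (simp add: \<mu>_def inf.absorb1)
  have "0 \<le> \<mu> A \<and> \<mu> A \<le> 1" for A
    using N sqnorm_nonneg[of "A \<inter> carrier G" v] sqnorm_mono_set[OF v, of "A \<inter> carrier G"]
    by (simp add: \<mu>_def)
  moreover have "\<mu> (carrier G) = 1"
    using N by (simp add: \<mu>_def)
  moreover have "\<mu> (A \<union> B) = \<mu> A + \<mu> B"
    if "A \<subseteq> carrier G" "B \<subseteq> carrier G" "A \<inter> B = {}" for A B
  proof -
    have "sqnorm (A \<union> B) v = sqnorm A v + sqnorm B v"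
      using sq_summable_subset[OF v] that unfolding sqnorm_def sq_summable_def
      by (intro infsum_Un_disjoint) auto
    then show ?thesis using that by (simp add: \<mu> add_divide_distrib)
  qed
  moreover have "\<bar>\<mu> (s <# A) - \<mu> A\<bar> \<le> \<delta>" if s: "s \<in> S" and A: "A \<subseteq> carrier G" for s A
  proof -
    have sG: "s \<in> carrier G" using s S by auto
    have "sqnorm (carrier G) (\<lambda>x. v x - v (inv s \<otimes> x)) \<le>
        (\<Sum>s\<in>S. sqnorm (carrier G) (\<lambda>x. v x - v (inv s \<otimes> x)))"
      by (rule member_le_sum[OF s]) (auto simp: S sqnorm_nonneg)
    then have D: "sqnorm (carrier G) (\<lambda>x. v x - v (inv s \<otimes> x)) \<le> 4 * c\<^sup>2 * ?N"
      using inv_v by linarith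
    have "\<bar>sqnorm (s <# A) v - sqnorm A v\<bar> \<le>
        sqnorm (carrier G) (\<lambda>x. v x - v (inv s \<otimes> x)) / (2 * c) + 2 * c * ?N"
      by (rule abs_sqnorm_l_coset_diff_le[OF v sG A \<open>0 < c\<close>])
    also have "\<dots> \<le> 4 * c\<^sup>2 * ?N / (2 * c) + 2 * c * ?N"
      using D \<open>0 < c\<close> by (intro add_mono divide_right_mono) auto
    also have "\<dots> = \<delta> * ?N"
      using \<open>0 < c\<close> by (simp add: c_def power2_eq_square field_simps)
    finally have "\<bar>sqnorm (s <# A) v - sqnorm A v\<bar> / ?N \<le> \<delta>"
      using N by (simp add: pos_divide_le_eq)
    moreover have "s <# A \<subseteq> carrier G"
      using sG A by (rule l_coset_subset_G[rotated])
    ultimately show ?thesis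
      using A N by (simp add: \<mu> flip: diff_divide_distrib)
  qed
  ultimately show "\<exists>\<mu> :: 'a set \<Rightarrow> real.
      (\<forall>A. 0 \<le> \<mu> A \<and> \<mu> A \<le> 1) \<and> \<mu> (carrier G) = 1 \<and>
      (\<forall>A B. A \<subseteq> carrier G \<longrightarrow> B \<subseteq> carrier G \<longrightarrow> A \<inter> B = {} \<longrightarrow> \<mu> (A \<union> B) = \<mu> A + \<mu> B) \<and>
      (\<forall>s\<in>S. \<forall>A. A \<subseteq> carrier G \<longrightarrow> \<bar>\<mu> (s <# A) - \<mu> A\<bar> \<le> \<delta>)"
    by (intro exI[of _ \<mu>]) blast
qed

end

section \<open>Folner sets\<close>

context group
begin

section \<open>Product sets and paradoxical doubling\<close>

lemma set_mult_singleton: "K <#> {x} = (\<lambda>k. k \<otimes> x) ` K"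
  by (auto simp: set_mult_def)

lemma finite_set_mult: "finite K \<Longrightarrow> finite F \<Longrightarrow> finite (K <#> F)"
  by (simp add: set_mult_def)

text \<open>For fixed \<open>b\<close>, the group is partitioned according to the multiplier
  \<open>k\<close> with \<open>c (x, b) = k \<otimes> x\<close>. The pieces, translated by their
  multipliers, partition the image of this copy, which therefore has measure 1. Two disjoint images
  of measure 1 do not fit into total mass 1.\<close>

lemma amenable_no_doubling_injection:
  fixes c :: "'a \<times> bool \<Rightarrow> 'a"
  assumes "amenable G" and K: "finite K" "K \<subseteq> carrier G"
    and inj: "inj_on c (carrier G \<times> UNIV)"
    and c: "\<And>x b. x \<in> carrier G \<Longrightarrow> c (x, b) \<in> K <#> {x}"
  shows False
proof -
  obtain \<mu> :: "'a set \<Rightarrow> real" where nonneg: "\<forall>A. A \<subseteq> carrier G \<longrightarrow> 0 \<le> \<mu> A"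
    and total: "\<mu> (carrier G) = 1"
    and add': "\<forall>A B. A \<subseteq> carrier G \<longrightarrow> B \<subseteq> carrier G \<longrightarrow> A \<inter> B = {} \<longrightarrow> \<mu> (A \<union> B) = \<mu> A + \<mu> B"
    and inv: "\<forall>g \<in> carrier G. \<forall>A. A \<subseteq> carrier G \<longrightarrow> \<mu> (g <# A) = \<mu> A"
    using \<open>amenable G\<close> unfolding amenable_def by (elim exE conjE) (rule that)
  have add: "\<mu> (A \<union> B) = \<mu> A + \<mu> B" if "A \<subseteq> carrier G" "B \<subseteq> carrier G" "A \<inter> B = {}" for A B
    using add' that by blast
  have "\<mu> {} = 0" using add[of "{}" "{}"] by simp
  have add_UN: "\<mu> (\<Union>k\<in>L. A k) = (\<Sum>k\<in>L. \<mu> (A k))"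
    if "finite L" "\<And>k. k \<in> L \<Longrightarrow> A k \<subseteq> carrier G" "disjoint_family_on A L" for A and L :: "'a set"
    using that
  proof (induction L)
    case (insert k L)
    have "\<mu> (A k \<union> (\<Union>l\<in>L. A l)) = \<mu> (A k) + \<mu> (\<Union>l\<in>L. A l)"
      using insert.prems insert.hyps by (intro add) (auto simp: disjoint_family_on_def)
    moreover have "disjoint_family_on A L"
      using insert.prems by (auto simp: disjoint_family_on_def)
    ultimately show ?case using insert by simp
  qed (simp add: \<open>\<mu> {} = 0\<close>)
  have c_in: "c (x, b) \<in> carrier G" if "x \<in> carrier G" for x b
    using c[OF that, of b] that K(2) by (auto simp: set_mult_singleton)
  have full: "\<mu> (c ` (carrier G \<times> {b})) = 1" for b
  proof -
    define B where "B k = {x \<in> carrier G. c (x, b) = k \<otimes> x}" for k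
    have B: "B k \<subseteq> carrier G" for k by (auto simp: B_def)
    have kB: "k <# B k \<subseteq> carrier G" if "k \<in> K" for k
      using K(2) that B[of k] by (intro l_coset_subset_G) auto
    have "c ` (carrier G \<times> {b}) = (\<Union>k\<in>K. k <# B k)"
    proof
      show "c ` (carrier G \<times> {b}) \<subseteq> (\<Union>k\<in>K. k <# B k)"
        using c[of _ b] by (fastforce simp: set_mult_singleton l_coset_def B_def)
      show "(\<Union>k\<in>K. k <# B k) \<subseteq> c ` (carrier G \<times> {b})"
        by (force simp: l_coset_def B_def image_iff)
    qed
    also have "\<mu> \<dots> = (\<Sum>k\<in>K. \<mu> (k <# B k))"
    proof (rule add_UN[OF K(1) kB])
      show "disjoint_family_on (\<lambda>k. k <# B k) K"
      proof (unfold disjoint_family_on_def, intro ballI impI equals0I)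
        \<comment> \<open>A point common to two translates has one preimage by injectivity of
          \<open>c\<close>; right cancellation then makes the two multipliers equal.\<close>
        fix k l y assume kl: "k \<in> K" "l \<in> K" "k \<noteq> l" "y \<in> (k <# B k) \<inter> (l <# B l)"
        then obtain x z where x: "x \<in> B k" "y = k \<otimes> x" and z: "z \<in> B l" "y = l \<otimes> z"
          by (auto simp: l_coset_def)
        then have "c (x, b) = c (z, b)" by (simp add: B_def)
        then have "x = z"
          using inj_onD[OF inj, of "(x, b)" "(z, b)"] x z by (auto simp: B_def)
        then have "k \<otimes> x = l \<otimes> x" "x \<in> carrier G"
          using x z by (auto simp: B_def)
        then show False using kl K(2) by (auto simp: subset_iff)
      qed
    qed
    also have "\<dots> = (\<Sum>k\<in>K. \<mu> (B k))"
      using K(2) B inv by (intro sum.cong refl) blast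
    also have "\<dots> = \<mu> (\<Union>k\<in>K. B k)"
      using K(2) B
      by (intro add_UN[symmetric] K(1)) (auto simp: disjoint_family_on_def B_def subset_iff)
    also have "(\<Union>k\<in>K. B k) = carrier G"
      using c[of _ b] by (auto simp: B_def set_mult_singleton)
    finally show ?thesis using total by simp
  qed
  let ?P = "c ` (carrier G \<times> {True})" and ?Q = "c ` (carrier G \<times> {False})"
  have PQ: "?P \<subseteq> carrier G" "?Q \<subseteq> carrier G"
    using c_in by auto
  have disj: "?P \<inter> ?Q = {}"
    using inj by (auto simp: inj_on_def)
  have "?P \<union> ?Q \<union> (carrier G - (?P \<union> ?Q)) = carrier G"
    using PQ by blast
  moreover have "\<mu> (?P \<union> ?Q \<union> (carrier G - (?P \<union> ?Q))) = \<mu> (?P \<union> ?Q) + \<mu> (carrier G - (?P \<union> ?Q))"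
    using PQ by (intro add) auto
  moreover have "\<mu> (?P \<union> ?Q) = 2"
    using add[OF PQ disj] full by simp
  moreover have "0 \<le> \<mu> (carrier G - (?P \<union> ?Q))"
    using nonneg by blast
  ultimately show False using total by simp
qed

text \<open>Otherwise Hall's condition holds for two copies of each \<open>x\<close> with candidate
  set \<open>K <#> {x}\<close>: a finite set of copies is at most twice as large as its projection,
  whose product with \<open>K\<close> is at least that large. The resulting injection is excluded by
  \<open>amenable_no_doubling_injection\<close>.\<close>

lemma amenable_small_product:
  assumes "amenable G" and K: "finite K" "K \<subseteq> carrier G"
  shows "\<exists>F. finite F \<and> F \<noteq> {} \<and> F \<subseteq> carrier G \<and> card (K <#> F) < 2 * card F"
proof (rule ccontr)
  assume "\<not> ?thesis"
  then have large: "2 * card F \<le> card (K <#> F)"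
    if "finite F" "F \<noteq> {}" "F \<subseteq> carrier G" for F
    using that by (meson not_le)
  define N where "N i = K <#> {fst i}" for i :: "'a \<times> bool"
  have "\<exists>c. inj_on c (carrier G \<times> (UNIV :: bool set)) \<and>
      (\<forall>i\<in>carrier G \<times> UNIV. c i \<in> N i)"
  proof (rule hall_marriage)
    show "finite (N i)" for i
      by (simp add: N_def finite_set_mult K)
    fix J :: "('a \<times> bool) set" assume J: "finite J" "J \<subseteq> carrier G \<times> UNIV"
    show "card J \<le> card (\<Union>(N ` J))"
    proof (cases "J = {}")
      case False
      have "J \<subseteq> fst ` J \<times> UNIV" by force
      then have "card J \<le> card (fst ` J \<times> (UNIV :: bool set))"
        using J by (intro card_mono) auto
      also have "\<dots> = 2 * card (fst ` J)"
        by (simp add: card_cartesian_product)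
      also have "\<dots> \<le> card (K <#> fst ` J)"
        using J False by (intro large) auto
      also have "K <#> fst ` J = \<Union>(N ` J)"
        unfolding set_mult_def N_def by blast
      finally show ?thesis .
    qed simp
  qed
  then obtain c where "inj_on c (carrier G \<times> (UNIV :: bool set))"
    "\<And>x b. x \<in> carrier G \<Longrightarrow> c (x, b) \<in> K <#> {x}"
    by (auto simp: N_def)
  then show False
    using amenable_no_doubling_injection[OF assms] by blast
qed

text \<open>If every finite set had a large boundary, multiplication by
  \<open>T = insert \<one> S\<close> would enlarge it by a fixed factor \<open>1 + c\<close>.
  Iteration makes a power of \<open>T\<close> more than double every nonempty finite set, against
  \<open>amenable_small_product\<close>.\<close>

lemma amenable_folner:
  fixes \<epsilon> :: real
  assumes "amenable G" and S: "finite S" "S \<subseteq> carrier G" and "0 < \<epsilon>"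
  shows "\<exists>F. finite F \<and> F \<noteq> {} \<and> F \<subseteq> carrier G \<and> (\<Sum>s\<in>S. card ((s <# F) - F)) \<le> \<epsilon> * card F"
proof (rule ccontr)
  assume "\<not> ?thesis"
  then have boundary: "\<epsilon> * card F < (\<Sum>s\<in>S. card ((s <# F) - F))"
    if "finite F" "F \<noteq> {}" "F \<subseteq> carrier G" for F
    using that by (meson not_le)
  \<comment> \<open>The unit ensures that \<open>T <#> F\<close> contains \<open>F\<close>, so its
    growth is measured by a difference containing every \<open>(s <# F) - F\<close>.\<close>
  define T where "T = insert \<one> S"
  define c where "c = \<epsilon> / (real (card S) + 1)"
  have "0 < c" using \<open>0 < \<epsilon>\<close> by (simp add: c_def add_pos_nonneg)
  have T: "finite T" "T \<subseteq> carrier G" using S by (auto simp: T_def)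
  have growth: "(1 + c) * card F \<le> card (T <#> F)"
    if F: "finite F" "F \<noteq> {}" "F \<subseteq> carrier G" for F
  proof -
    have fin: "finite (T <#> F)" using T F by (intro finite_set_mult)
    have sub: "F \<subseteq> T <#> F" and "\<And>s. s \<in> S \<Longrightarrow> s <# F \<subseteq> T <#> F"
      using F by (force simp: T_def set_mult_def l_coset_def)+
    then have "card ((s <# F) - F) \<le> card ((T <#> F) - F)" if "s \<in> S" for s
      using fin that by (intro card_mono) auto
    then have "(\<Sum>s\<in>S. card ((s <# F) - F)) \<le> card S * card ((T <#> F) - F)"
      using sum_bounded_above[of S "\<lambda>s. card ((s <# F) - F)"] by simp
    then have "(\<Sum>s\<in>S. card ((s <# F) - F)) \<le> real (card S) * real (card ((T <#> F) - F))"
      by (metis of_nat_le_iff of_nat_mult)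
    also have "\<dots> \<le> (real (card S) + 1) * card ((T <#> F) - F)"
      by (intro mult_right_mono) auto
    finally have "\<epsilon> * card F \<le> (real (card S) + 1) * card ((T <#> F) - F)"
      using boundary[OF F] by linarith
    then have "c * card F \<le> card ((T <#> F) - F)"
      by (simp add: c_def pos_divide_le_eq add_pos_nonneg mult.commute)
    moreover have "card (T <#> F) = card F + card ((T <#> F) - F)"
      using card_Diff_subset[OF F(1) sub] card_mono[OF fin sub] by simp
    ultimately show ?thesis by (simp add: algebra_simps)
  qed
  \<comment> \<open>The \<open>n\<close>-fold product set of \<open>T\<close>, starting from the
    trivial subgroup.\<close>
  define K where "K n = ((\<lambda>L. T <#> L) ^^ n) {\<one>}" for n
  have K_Suc: "K (Suc n) = T <#> K n" for n by (simp add: K_def)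
  have K: "finite (K n) \<and> K n \<subseteq> carrier G" for n
  proof (induction n)
    case (Suc n)
    then show ?case using T by (simp add: K_Suc finite_set_mult setmult_subset_G)
  qed (simp add: K_def)
  have K_growth: "(1 + c) ^ n * card F \<le> card (K n <#> F)"
    if F: "finite F" "F \<noteq> {}" "F \<subseteq> carrier G" for F n
  proof (induction n)
    case 0
    have "K 0 <#> F = F" using F by (force simp: K_def set_mult_def)
    then show ?case by simp
  next
    case (Suc n)
    have KF: "finite (K n <#> F)" "K n <#> F \<subseteq> carrier G"
      using K[of n] F by (simp_all add: finite_set_mult setmult_subset_G)
    have "0 < (1 + c) ^ n * card F"
      using F \<open>0 < c\<close> by (simp add: card_gt_0_iff)
    then have ne: "K n <#> F \<noteq> {}"
      using Suc by auto
    have "(1 + c) ^ Suc n * card F = (1 + c) * ((1 + c) ^ n * card F)"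
      by simp
    also have "\<dots> \<le> (1 + c) * card (K n <#> F)"
      using Suc \<open>0 < c\<close> by (intro mult_left_mono) auto
    also have "\<dots> \<le> card (T <#> (K n <#> F))"
      by (rule growth[OF KF(1) ne KF(2)])
    also have "T <#> (K n <#> F) = K (Suc n) <#> F"
      using T K F by (simp add: K_Suc set_mult_assoc)
    finally show ?case .
  qed
  obtain n where n: "2 < (1 + c) ^ n"
    using real_arch_pow[of "1 + c" 2] \<open>0 < c\<close> by auto
  obtain F where F: "finite F" "F \<noteq> {}" "F \<subseteq> carrier G" "card (K n <#> F) < 2 * card F"
    using amenable_small_product[OF \<open>amenable G\<close>, of "K n"] K by blast
  have "2 * real (card F) \<le> (1 + c) ^ n * card F"
    using n by (intro mult_right_mono) auto
  also have "\<dots> \<le> card (K n <#> F)"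
    by (rule K_growth[OF F(1-3)])
  finally show False using F(4) by simp
qed

end

section \<open>The divergence is not onto\<close>

lemma sum_abs_le_sqnorm:
  assumes "sq_summable A f" "finite B" "B \<subseteq> A"
  shows "(\<Sum>x\<in>B. \<bar>f x\<bar>) \<le> sqrt (sqnorm A f) * sqrt (card B)"
proof -
  have "(\<Sum>x\<in>B. \<bar>f x\<bar> * \<bar>1\<bar>) \<le> L2_set f B * L2_set (\<lambda>x. 1) B"
    by (rule L2_set_mult_ineq)
  also have "\<dots> \<le> sqrt (sqnorm A f) * sqrt (card B)"
    using L2_set_le_sqnorm[OF assms] by (simp add: L2_set_constant mult_right_mono)
  finally show ?thesis by simp
qed

text \<open>The common part of \<open>F\<close> and \<open>F'\<close> cancels. The two remaining
  differences have the same size because \<open>F\<close> and \<open>F'\<close> do, and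
  Cauchy-Schwarz against the constant 1 bounds each sum.\<close>

lemma sum_diff_le_boundary:
  assumes h: "sq_summable A h" and F: "finite F" "F \<subseteq> A" and F': "finite F'" "F' \<subseteq> A"
    and "card F' = card F"
  shows "sum h F - sum h F' \<le> 2 * sqrt (sqnorm A h) * sqrt (card (F' - F))"
proof -
  have card: "card (F - F') = card (F' - F)"
    using card_Diff_subset_Int[of F F'] card_Diff_subset_Int[of F' F] F F' assms(6)
    by (simp add: Int_commute)
  have "sum h F - sum h F' = sum h (F - F') - sum h (F' - F)"
    using F F' sum.Int_Diff[of F h F'] sum.Int_Diff[of F' h F] by (simp add: Int_commute)
  also have "\<dots> \<le> (\<Sum>x\<in>F - F'. \<bar>h x\<bar>) + (\<Sum>x\<in>F' - F. \<bar>h x\<bar>)"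
    using sum_abs[of h "F - F'"] sum_abs[of h "F' - F"] by linarith
  also have "\<dots> \<le> sqrt (sqnorm A h) * sqrt (card (F - F')) + sqrt (sqnorm A h) * sqrt (card (F' - F))"
    using F F' h by (intro add_mono sum_abs_le_sqnorm) auto
  finally show ?thesis unfolding card by simp
qed

(* The gliding hump: superpose normalised indicators of ever more invariant sets. *)
lemma (in group) amenable_divergence_not_surj:
  assumes "amenable G" and S: "finite S" "S \<subseteq> carrier G"
  shows "\<exists>f. sq_summable (carrier G) f \<and> (\<forall>h. (\<forall>s\<in>S. sq_summable (carrier G) (h s)) \<longrightarrow>
    \<not> (\<forall>x\<in>carrier G. f x = (\<Sum>s\<in>S. h s x - h s (inv s \<otimes> x))))"
proof -
  \<comment> \<open>Inverses appear because the divergence translates by \<open>inv s\<close>. The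
    rate is 16^(-n) because its square root 4^(-n) must beat the weight 2^(-n) in the
    superposition.\<close>
  have "\<exists>F. finite F \<and> F \<noteq> {} \<and> F \<subseteq> carrier G \<and>
      (\<Sum>s\<in>m_inv G ` S. card ((s <# F) - F)) \<le> (1/16)^n * card F" for n
    using S by (intro amenable_folner[OF \<open>amenable G\<close>]) auto
  then obtain F where F: "\<And>n. finite (F n)" "\<And>n. F n \<noteq> {}" "\<And>n. F n \<subseteq> carrier G"
    and Fol: "\<And>n. (\<Sum>s\<in>m_inv G ` S. card ((s <# F n) - F n)) \<le> (1/16)^n * card (F n)"
    by metis
  have N: "0 < card (F n)" for n using F by (simp add: card_gt_0_iff)
  define u where "u n x = (1/2)^n * (if x \<in> F n then 1 / sqrt (card (F n)) else 0)" for n x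
  define f where "f x = suminf (\<lambda>n. u n x)" for x
  have bound: "L2_set (u n) B \<le> (1/2)^n" if "finite B" "B \<subseteq> carrier G" for n B
  proof -
    have "(\<Sum>x\<in>B. (if x \<in> F n then 1 / sqrt (card (F n)) else 0)\<^sup>2) = (\<Sum>x\<in>B \<inter> F n. 1 / card (F n))"
      unfolding sum.inter_restrict[OF that(1)] using N[of n]
      by (intro sum.cong) (auto simp: power_divide)
    also have "\<dots> \<le> 1"
      using card_mono[OF F(1)[of n], of "B \<inter> F n"] N[of n] by simp
    finally have "L2_set (\<lambda>x. if x \<in> F n then 1 / sqrt (card (F n)) else 0) B \<le> 1"
      by (simp add: L2_set_def)
    then show ?thesis
      unfolding u_def by (subst L2_set_right_distrib[symmetric]) simp_all
  qed
  have geo: "summable (\<lambda>n. (1/2::real)^n)"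
    by (rule summable_geometric) simp
  have f: "sq_summable (carrier G) f"
    unfolding f_def using sq_summable_suminf(2)[OF bound geo] .
  \<comment> \<open>All summands are nonnegative, so no later or earlier hump can cancel the
    \<open>n\<close>-th one.\<close>
  have f_ge: "u n x \<le> f x" if "x \<in> carrier G" for n x
  proof -
    have "sum (\<lambda>n. u n x) {n} \<le> suminf (\<lambda>n. u n x)"
      by (rule sum_le_suminf[OF sq_summable_suminf(1)[OF bound geo that]]) (auto simp: u_def)
    then show ?thesis by (simp add: f_def)
  qed
  have False if h: "\<forall>s\<in>S. sq_summable (carrier G) (h s)"
    and eq: "\<forall>x\<in>carrier G. f x = (\<Sum>s\<in>S. h s x - h s (inv s \<otimes> x))" for h
  proof -
    define M where "M = (\<Sum>s\<in>S. 2 * sqrt (sqnorm (carrier G) (h s)))"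
    \<comment> \<open>Summing the equation over \<open>F n\<close> gives at least 2^(-n) sqrt |F n|
      on the left, whereas on the right only boundary terms survive, at most M 4^(-n) sqrt |F
      n|.\<close>
    have "2 ^ n \<le> M" for n
    proof -
      let ?F = "F n" and ?r = "sqrt (card (F n))"
      have r: "0 < ?r" using N by simp
      have "(1/2)^n * ?r = (\<Sum>x\<in>?F. (1/2)^n * (1 / ?r))"
        using r by (simp add: field_simps)
      also have "\<dots> = (\<Sum>x\<in>?F. u n x)"
        by (simp add: u_def)
      also have "\<dots> \<le> (\<Sum>x\<in>?F. f x)"
        using F f_ge by (intro sum_mono) blast
      also have "\<dots> = (\<Sum>x\<in>?F. \<Sum>s\<in>S. h s x - h s (inv s \<otimes> x))"
        using F eq by (intro sum.cong refl) blast
      also have "\<dots> = (\<Sum>s\<in>S. \<Sum>x\<in>?F. h s x - h s (inv s \<otimes> x))"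
        by (rule sum.swap)
      also have "\<dots> \<le> (\<Sum>s\<in>S. 2 * sqrt (sqnorm (carrier G) (h s)) * ((1/4)^n * ?r))"
      proof (rule sum_mono)
        fix s assume s: "s \<in> S"
        let ?F' = "inv s <# ?F"
        have sG: "s \<in> carrier G" using s S by auto
        have image: "?F' = (\<lambda>x. inv s \<otimes> x) ` ?F"
          by (auto simp: l_coset_def)
        have inj: "inj_on (\<lambda>x. inv s \<otimes> x) ?F"
          using sG F(3)[of n] by (auto simp: inj_on_def subset_iff)
        have F': "finite ?F'" "?F' \<subseteq> carrier G" "card ?F' = card ?F"
          using image inj F(1)[of n] l_coset_subset_G[OF F(3), of "inv s" n] sG card_image[OF inj]
          by auto
        have "(\<Sum>x\<in>?F. h s x - h s (inv s \<otimes> x)) = sum (h s) ?F - sum (h s) ?F'"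
          unfolding image by (simp add: sum_subtractf sum.reindex[OF inj])
        also have "\<dots> \<le> 2 * sqrt (sqnorm (carrier G) (h s)) * sqrt (card (?F' - ?F))"
          using h s F F' by (intro sum_diff_le_boundary) auto
        also have "\<dots> \<le> 2 * sqrt (sqnorm (carrier G) (h s)) * ((1/4)^n * ?r)"
        proof (rule mult_left_mono)
          have "card (?F' - ?F) \<le> (\<Sum>s\<in>m_inv G ` S. card ((s <# ?F) - ?F))"
            using s S by (intro member_le_sum) auto
          then have "real (card (?F' - ?F)) \<le> (1/16)^n * card ?F"
            using Fol[of n] by linarith
          also have "(1/16::real)^n = ((1/4)^n)\<^sup>2"
            by (simp add: power2_eq_square flip: power_mult_distrib)
          also have "((1/4)^n)\<^sup>2 * card ?F = ((1/4)^n * ?r)\<^sup>2"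
            by (simp add: power_mult_distrib)
          finally show "sqrt (card (?F' - ?F)) \<le> (1/4)^n * ?r"
            using r by (intro real_le_lsqrt) auto
        qed (simp add: sqnorm_nonneg)
        finally show "(\<Sum>x\<in>?F. h s x - h s (inv s \<otimes> x)) \<le>
            2 * sqrt (sqnorm (carrier G) (h s)) * ((1/4)^n * ?r)" .
      qed
      also have "\<dots> = M * (1/4)^n * ?r"
        by (simp add: M_def sum_distrib_right mult.assoc)
      finally have "(1/2)^n \<le> M * (1/4)^n"
        using r by simp
      then have "(1/2)^n * 4^n \<le> M * (1/4)^n * 4^n"
        by (rule mult_right_mono) simp
      then show ?thesis
        by (simp add: mult.assoc flip: power_mult_distrib)
    qed
    then show False
      using real_arch_pow[of 2 M] by (metis not_le one_less_numeral_iff semiring_norm(76))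
  qed
  then show ?thesis using f by blast
qed

text \<open>A basis of \<open>W\<close> stays independent when \<open>f\<close> is adjoined, so a
  linear map may be prescribed as 0 on the basis and \<open>c\<close> at \<open>f\<close>.\<close>

lemma exists_additive_functional:
  fixes W :: "('a \<Rightarrow> real) set" and f :: "'a \<Rightarrow> real"
  assumes W0: "(\<lambda>x. 0) \<in> W"
    and W_add: "\<And>u v. u \<in> W \<Longrightarrow> v \<in> W \<Longrightarrow> (\<lambda>x. u x + v x) \<in> W"
    and W_scale: "\<And>c u. u \<in> W \<Longrightarrow> (\<lambda>x. c * u x) \<in> W"
    and "f \<notin> W"
  shows "\<exists>\<psi> :: ('a \<Rightarrow> real) \<Rightarrow> real. (\<forall>u v. \<psi> (\<lambda>x. u x + v x) = \<psi> u + \<psi> v) \<and>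
    (\<forall>w\<in>W. \<psi> w = 0) \<and> \<psi> f = c"
proof -
  interpret vector_space_pair "\<lambda>(r::real) (f::'a \<Rightarrow> real) x. r * f x" "(*) :: real \<Rightarrow> real \<Rightarrow> real"
    by unfold_locales (auto simp: fun_eq_iff algebra_simps)
  have sub: "vs1.subspace W"
    using W0 W_add W_scale by (auto simp: vs1.subspace_def zero_fun_def plus_fun_def)
  obtain B where B: "B \<subseteq> W" "vs1.independent B" "W \<subseteq> vs1.span B"
    using vs1.maximal_independent_subset by blast
  have "vs1.span B \<subseteq> W"
    by (rule vs1.span_minimal[OF B(1) sub])
  then have f: "f \<notin> vs1.span B" using \<open>f \<notin> W\<close> by blast
  then have "vs1.independent (insert f B)"
    using B(2) by (rule vs1.independent_insertI)
  then obtain \<psi> where lin: "Vector_Spaces.linear (\<lambda>r f x. r * f x) (*) \<psi>"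
    and \<psi>: "\<forall>v\<in>insert f B. \<psi> v = (if v = f then c else 0)"
    using linear_independent_extend[of "insert f B" "\<lambda>v. if v = f then c else 0"] by blast
  interpret \<psi>: Vector_Spaces.linear "\<lambda>r f x. r * f x" "(*)" \<psi> by (rule lin)
  have "f \<notin> B" using f vs1.span_base by blast
  then have "\<psi> v = 0" if "v \<in> B" for v
    using \<psi> that by auto
  then have "\<psi> w = 0" if "w \<in> W" for w
    using linear_eq_0_on_span[OF lin] B(3) that by blast
  moreover have "\<psi> (\<lambda>x. u x + v x) = \<psi> u + \<psi> v" for u v
    using \<psi>.add[of u v] by (simp add: plus_fun_def)
  ultimately show ?thesis using \<psi> by (intro exI[of _ \<psi>]) simp
qed

section \<open>Invariant homomorphisms\<close>

lemma L2_iff: "f \<in> L2 G \<longleftrightarrow> f \<in> extensional (carrier G) \<and> sq_summable (carrier G) f"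
  by (simp add: L2_def sq_summable_def)

text \<open>Induction on the generated subgroup, using that lambda_g lambda_h = lambda_gh; for the
  inverse of a generator \<open>s\<close>, invariance under \<open>s\<close> is applied to the
  translate by \<open>inv s\<close>.\<close>

lemma (in group) left_regular_invariant_generate:
  assumes S: "S \<subseteq> carrier G"
    and inv: "\<And>s f. s \<in> S \<Longrightarrow> f \<in> L2 G \<Longrightarrow> \<Phi> (left_regular G s f) = \<Phi> f"
    and "g \<in> generate G S" and f: "f \<in> L2 G"
  shows "\<Phi> (left_regular G g f) = \<Phi> f"
  using assms(3) f
proof (induction arbitrary: f rule: generate.induct)
  case one
  then have "left_regular G \<one> f = f"
    by (auto simp: left_regular_def L2_iff extensional_def)
  then show ?case by simp
next
  case (incl s)
  then show ?case by (rule inv)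
next
  case (inv s)
  then have s: "s \<in> carrier G" using S by auto
  then have "left_regular G (inv s) f \<in> L2 G"
    using inv.prems by (intro left_regular_in_L2) auto
  then have "\<Phi> (left_regular G s (left_regular G (inv s) f)) = \<Phi> (left_regular G (inv s) f)"
    using assms(2) inv.hyps by blast
  moreover have "left_regular G s (left_regular G (inv s) f) = f"
    using s inv.prems
    by (auto simp: left_regular_def L2_iff extensional_def fun_eq_iff m_assoc[symmetric])
  ultimately show ?case by simp
next
  case (eng g h)
  have gh: "g \<in> carrier G" "h \<in> carrier G"
    using eng.hyps generate_in_carrier[OF S] by auto
  then have "left_regular G h f \<in> L2 G"
    using eng.prems by (intro left_regular_in_L2) auto
  then have "\<Phi> (left_regular G g (left_regular G h f)) = \<Phi> (left_regular G h f)"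
    by (rule eng.IH(1))
  also have "\<dots> = \<Phi> f" by (rule eng.IH(2)[OF eng.prems])
  also have "left_regular G g (left_regular G h f) = left_regular G (g \<otimes> h) f"
    using gh by (auto simp: left_regular_def fun_eq_iff m_assoc inv_mult_group)
  finally show ?case .
qed

section \<open>The circle as a quotient of the reals\<close>

lemma subgroup_Ints_real_group: "subgroup \<int> real_group"
proof -
  interpret comm_group real_group by (rule comm_group_real_group)
  show ?thesis
    by (rule subgroup.intro) (auto simp: inv_real_group, auto simp: real_group_def)
qed

lemma coset_hom_circle_group: "(\<lambda>r. \<int> #>\<^bsub>real_group\<^esub> r) \<in> hom real_group circle_group"
proof -
  interpret comm_group real_group by (rule comm_group_real_group)
  interpret normal "\<int>" real_group
    by (rule subgroup_imp_normal[OF subgroup_Ints_real_group])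
  show ?thesis unfolding circle_group_def by (rule r_coset_hom_Mod)
qed

text \<open>Real functionals are normalised to the value 1/2, so that they stay nonzero after
  reduction modulo the integers.\<close>

lemma coset_half_neq_one: "\<int> #>\<^bsub>real_group\<^esub> (1/2) \<noteq> \<one>\<^bsub>circle_group\<^esub>"
proof
  assume "\<int> #>\<^bsub>real_group\<^esub> (1/2) = \<one>\<^bsub>circle_group\<^esub>"
  then have "(\<Union>x\<in>\<int>. {x + 1/2}) = (\<int> :: real set)"
    by (simp add: circle_group_def FactGroup_def r_coset_def real_group_def)
  then have "0 + 1/2 \<in> (\<int> :: real set)"
    using Ints_0 by blast
  then obtain k :: int where "1/2 = (of_int k :: real)"
    by (auto elim: Ints_cases)
  then have "of_int (2 * k) = (of_int 1 :: real)" by simp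
  then have "2 * k = 1" by (simp only: of_int_eq_iff)
  then show False by presburger
qed

lemma (in group) amenable_imp_invariant_hom:
  assumes "amenable G" and S: "finite S" "S \<subseteq> carrier G" "generate G S = carrier G"
  shows "\<exists>\<phi> \<in> hom (L2_group G) circle_group.
    (\<exists>f \<in> L2 G. \<phi> f \<noteq> \<one>\<^bsub>circle_group\<^esub>) \<and>
    (\<forall>f \<in> L2 G. \<forall>g \<in> carrier G. \<phi> f = \<phi> (left_regular G g f))"
proof -
  \<comment> \<open>Extension by zero turns the addition of \<open>L2_group\<close>, whose elements
    are \<open>undefined\<close> off the carrier, into plain pointwise addition, where linear
    algebra applies.\<close>
  define \<zeta> where "\<zeta> u = (\<lambda>x. if x \<in> carrier G then u x else 0)" for u :: "'a \<Rightarrow> real"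
  define D where "D h x = (\<Sum>s\<in>S. h s x - h s (inv s \<otimes> x))" for h :: "'a \<Rightarrow> 'a \<Rightarrow> real" and x
  define W where "W = {\<zeta> (D h) |h. \<forall>s\<in>S. sq_summable (carrier G) (h s)}"
  obtain f where f: "sq_summable (carrier G) f"
    and f_notin: "\<And>h. \<forall>s\<in>S. sq_summable (carrier G) (h s) \<Longrightarrow> \<not> (\<forall>x\<in>carrier G. f x = D h x)"
    using amenable_divergence_not_surj[OF \<open>amenable G\<close> S(1,2)] unfolding D_def by blast
  have "\<exists>\<psi> :: ('a \<Rightarrow> real) \<Rightarrow> real. (\<forall>u v. \<psi> (\<lambda>x. u x + v x) = \<psi> u + \<psi> v) \<and>
    (\<forall>w\<in>W. \<psi> w = 0) \<and> \<psi> (\<zeta> f) = 1/2"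
  proof (rule exists_additive_functional)
    have "(\<lambda>x. 0) = \<zeta> (D (\<lambda>s x. 0))"
      by (auto simp: \<zeta>_def D_def)
    then show "(\<lambda>x. 0) \<in> W"
      unfolding W_def using sq_summable_0 by blast
    show "(\<lambda>x. u x + v x) \<in> W" if "u \<in> W" "v \<in> W" for u v
    proof -
      obtain h k where "u = \<zeta> (D h)" "\<forall>s\<in>S. sq_summable (carrier G) (h s)"
        "v = \<zeta> (D k)" "\<forall>s\<in>S. sq_summable (carrier G) (k s)"
        using \<open>u \<in> W\<close> \<open>v \<in> W\<close> unfolding W_def by blast
      then have "(\<lambda>x. u x + v x) = \<zeta> (D (\<lambda>s x. h s x + k s x))"
        "\<forall>s\<in>S. sq_summable (carrier G) (\<lambda>x. h s x + k s x)"
        by (auto simp: \<zeta>_def D_def fun_eq_iff sum.distrib[symmetric] sq_summable_add intro!: sum.cong)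
      then show ?thesis unfolding W_def by blast
    qed
    show "(\<lambda>x. c * u x) \<in> W" if "u \<in> W" for c u
    proof -
      obtain h where "u = \<zeta> (D h)" "\<forall>s\<in>S. sq_summable (carrier G) (h s)"
        using \<open>u \<in> W\<close> unfolding W_def by blast
      then have "(\<lambda>x. c * u x) = \<zeta> (D (\<lambda>s x. c * h s x))"
        "\<forall>s\<in>S. sq_summable (carrier G) (\<lambda>x. c * h s x)"
        by (auto simp: \<zeta>_def D_def fun_eq_iff sum_distrib_left right_diff_distrib sq_summable_cmult)
      then show ?thesis unfolding W_def by blast
    qed
    show "\<zeta> f \<notin> W"
    proof
      assume "\<zeta> f \<in> W"
      then obtain h where h: "\<forall>s\<in>S. sq_summable (carrier G) (h s)" and eq: "\<zeta> f = \<zeta> (D h)"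
        unfolding W_def by blast
      have "f x = D h x" if "x \<in> carrier G" for x
        using fun_cong[OF eq, of x] that by (simp add: \<zeta>_def)
      then show False using f_notin[OF h] by blast
    qed
  qed
  then obtain \<psi> :: "('a \<Rightarrow> real) \<Rightarrow> real"
    where \<psi>_add: "\<And>u v. \<psi> (\<lambda>x. u x + v x) = \<psi> u + \<psi> v"
      and \<psi>_W: "\<And>w. w \<in> W \<Longrightarrow> \<psi> w = 0" and \<psi>_f: "\<psi> (\<zeta> f) = 1/2"
    by blast
  have gen_inv: "\<psi> (\<zeta> (left_regular G s u)) = \<psi> (\<zeta> u)" if s: "s \<in> S" and u: "u \<in> L2 G" for s u
  proof -
    \<comment> \<open>Concentrating the family at the single index \<open>s\<close> exhibits u -
      lambda_s u as a divergence, so it lies in the kernel of \<open>\<psi>\<close>.\<close>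
    define h where "h t = (if t = s then u else (\<lambda>x. 0))" for t
    have "D h x = u x - u (inv s \<otimes> x)" for x
    proof -
      have "D h x = (\<Sum>t\<in>S. if t = s then u x - u (inv s \<otimes> x) else 0)"
        unfolding D_def h_def by (intro sum.cong) auto
      then show ?thesis using s S(1) by simp
    qed
    then have "\<zeta> u = (\<lambda>x. \<zeta> (left_regular G s u) x + \<zeta> (D h) x)"
      by (auto simp: \<zeta>_def left_regular_def)
    then have "\<psi> (\<zeta> u) = \<psi> (\<zeta> (left_regular G s u)) + \<psi> (\<zeta> (D h))"
      using \<psi>_add by metis
    moreover have "\<forall>t\<in>S. sq_summable (carrier G) (h t)"
      using u by (simp add: h_def L2_iff sq_summable_0)
    then have "\<zeta> (D h) \<in> W"
      unfolding W_def by blast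
    ultimately show ?thesis using \<psi>_W by simp
  qed
  have invariant: "\<psi> (\<zeta> (left_regular G g u)) = \<psi> (\<zeta> u)" if "g \<in> carrier G" "u \<in> L2 G" for g u
    using left_regular_invariant_generate[OF S(2), of "\<lambda>u. \<psi> (\<zeta> u)"] gen_inv that S(3) by blast
  have "(\<lambda>u. \<psi> (\<zeta> u)) \<in> hom (L2_group G) real_group"
  proof (rule homI)
    fix u v
    have "\<zeta> (u \<otimes>\<^bsub>L2_group G\<^esub> v) = (\<lambda>x. \<zeta> u x + \<zeta> v x)"
      by (auto simp: \<zeta>_def L2_group_def)
    then show "\<psi> (\<zeta> (u \<otimes>\<^bsub>L2_group G\<^esub> v)) = \<psi> (\<zeta> u) \<otimes>\<^bsub>real_group\<^esub> \<psi> (\<zeta> v)"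
      by (simp add: \<psi>_add real_group_def)
  qed (simp add: real_group_def)
  from Group.hom_compose[OF this coset_hom_circle_group]
  have hom: "(\<lambda>u. \<int> #>\<^bsub>real_group\<^esub> \<psi> (\<zeta> u)) \<in> hom (L2_group G) circle_group"
    by (simp add: comp_def)
  let ?f = "restrict f (carrier G)"
  have "?f \<in> L2 G"
    using f sq_summable_cong[of "carrier G" f ?f] by (simp add: L2_iff)
  moreover have "\<zeta> ?f = \<zeta> f" by (auto simp: \<zeta>_def)
  then have "\<int> #>\<^bsub>real_group\<^esub> \<psi> (\<zeta> ?f) \<noteq> \<one>\<^bsub>circle_group\<^esub>"
    using coset_half_neq_one by (simp add: \<psi>_f)
  ultimately show ?thesis
    using hom invariant by (intro bexI[OF _ hom]) auto
qed

text \<open>For one generator, h is the sum of h - lambda_s h and lambda_s h; as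
  \<open>\<phi>\<close> agrees on h and lambda_s h, cancellation in the circle kills the difference.
  Additivity extends this to finite sums, membership in \<open>L2\<close> being carried along
  because \<open>\<phi>\<close> is additive only there.\<close>

lemma (in group) invariant_hom_sum_differences:
  assumes \<phi>: "\<phi> \<in> hom (L2_group G) circle_group"
    and inv: "\<And>f g. f \<in> L2 G \<Longrightarrow> g \<in> carrier G \<Longrightarrow> \<phi> f = \<phi> (left_regular G g f)"
    and S: "finite S" "S \<subseteq> carrier G" and h: "h \<in> L2 G"
  shows "(\<lambda>x\<in>carrier G. \<Sum>s\<in>S. h x - left_regular G s h x) \<in> L2 G \<and>
    \<phi> (\<lambda>x\<in>carrier G. \<Sum>s\<in>S. h x - left_regular G s h x) = \<one>\<^bsub>circle_group\<^esub>"
proof -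
  interpret T: comm_group circle_group by (rule comm_group_circle_group)
  interpret L: comm_group "L2_group G" by (rule comm_group_L2_group)
  interpret \<phi>: group_hom "L2_group G" circle_group \<phi>
    using \<phi> by (unfold_locales)
  have carrier_L2: "carrier (L2_group G) = L2 G" by (simp add: L2_group_def)
  have \<phi>_add: "\<phi> (\<lambda>x\<in>carrier G. u x + v x) = \<phi> u \<otimes>\<^bsub>circle_group\<^esub> \<phi> v" if "u \<in> L2 G" "v \<in> L2 G" for u v
    using \<phi>.hom_mult[of u v] that unfolding carrier_L2 by (simp add: L2_group_def)
  have \<phi>_closed: "\<phi> u \<in> carrier circle_group" if "u \<in> L2 G" for u
    using \<phi>.hom_closed that by (simp add: carrier_L2)
  show ?thesis using S
  proof (induction S)
    case empty
    have zero: "(\<lambda>x\<in>carrier G. \<Sum>s\<in>{}. h x - left_regular G s h x) = \<one>\<^bsub>L2_group G\<^esub>"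
      by (simp add: L2_group_def)
    show ?case
      unfolding zero using \<phi>.hom_one L.one_closed unfolding carrier_L2 by simp
  next
    case (insert s S)
    define d where "d = (\<lambda>x\<in>carrier G. h x - left_regular G s h x)"
    have s: "s \<in> carrier G" using insert.prems by simp
    have sh: "left_regular G s h \<in> L2 G"
      using s h by (intro left_regular_in_L2) auto
    have d: "d \<in> L2 G"
      using sq_summable_diff[of "carrier G" h "left_regular G s h"] h sh
        sq_summable_cong[of "carrier G" d "\<lambda>x. h x - left_regular G s h x"]
      by (simp add: L2_iff d_def)
    have "(\<lambda>x\<in>carrier G. d x + left_regular G s h x) = h"
      using h by (auto simp: d_def L2_iff extensional_def)
    then have "\<phi> d \<otimes>\<^bsub>circle_group\<^esub> \<phi> h = \<phi> h"
      using \<phi>_add[OF d sh] inv[OF h s] by simp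
    then have \<phi>_d: "\<phi> d = \<one>\<^bsub>circle_group\<^esub>"
      using \<phi>_closed d h T.r_cancel_one by simp
    let ?r = "\<lambda>x\<in>carrier G. \<Sum>s\<in>S. h x - left_regular G s h x"
    have r: "?r \<in> L2 G" "\<phi> ?r = \<one>\<^bsub>circle_group\<^esub>"
      using insert.IH insert.prems by blast+
    have eq: "(\<lambda>x\<in>carrier G. \<Sum>s\<in>insert s S. h x - left_regular G s h x) = (\<lambda>x\<in>carrier G. d x + ?r x)"
      using insert.hyps by (auto simp: d_def)
    have "\<phi> (\<lambda>x\<in>carrier G. d x + ?r x) = \<one>\<^bsub>circle_group\<^esub>"
      unfolding \<phi>_add[OF d r(1)] r(2) \<phi>_d by simp
    then show ?case
      unfolding eq using L2_add[OF d r(1)] by blast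
  qed
qed

lemma (in group) invariant_hom_imp_amenable:
  assumes \<phi>: "\<phi> \<in> hom (L2_group G) circle_group"
    and f: "f \<in> L2 G" "\<phi> f \<noteq> \<one>\<^bsub>circle_group\<^esub>"
    and inv: "\<And>f g. f \<in> L2 G \<Longrightarrow> g \<in> carrier G \<Longrightarrow> \<phi> f = \<phi> (left_regular G g f)"
    and S: "finite S" "S \<subseteq> carrier G" "generate G S = carrier G"
  shows "amenable G"
proof (rule amenable_of_almost_invariant_vectors[OF S], rule ccontr)
  fix \<epsilon> :: real
  assume "0 < \<epsilon>" and "\<not> (\<exists>v. sq_summable (carrier G) v \<and>
    (\<Sum>s\<in>S. sqnorm (carrier G) (\<lambda>x. v x - v (inv s \<otimes> x))) < \<epsilon> * sqnorm (carrier G) v)"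
  \<comment> \<open>The negation of almost invariance at \<open>\<epsilon>\<close> is the gap
    hypothesis of \<open>laplacian_surj\<close>. Hence the vector \<open>f\<close> on which
    \<open>\<phi>\<close> is nontrivial is itself a sum of differences, on which
    \<open>\<phi>\<close> is trivial.\<close>
  then have gap: "\<epsilon> * sqnorm (carrier G) v \<le> (\<Sum>s\<in>S. sqnorm (carrier G) (\<lambda>x. v x - v (inv s \<otimes> x)))"
    if "sq_summable (carrier G) v" for v
    using that by (meson not_le)
  have bij: "bij_betw (\<lambda>x. inv s \<otimes> x) (carrier G) (carrier G)" if "s \<in> S" for s
    using that S(2) by (intro bij_betw_translate) auto
  have "sq_summable (carrier G) f" using f by (simp add: L2_iff)
  from laplacian_surj[where \<sigma> = "\<lambda>s x. inv s \<otimes> x", OF S(1) bij \<open>0 < \<epsilon>\<close> gap this]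
  obtain h where h: "sq_summable (carrier G) h"
    and lap: "\<And>x. x \<in> carrier G \<Longrightarrow> laplacian S (\<lambda>s x. inv s \<otimes> x) h x = f x"
    by blast
  \<comment> \<open>The solution \<open>h\<close> has arbitrary values off the carrier; restricting
    it yields an element of \<open>L2\<close> with the same Laplacian on the carrier.\<close>
  let ?h = "restrict h (carrier G)"
  have h_L2: "?h \<in> L2 G"
    using h sq_summable_cong[of "carrier G" h ?h] by (simp add: L2_iff)
  have "(\<Sum>s\<in>S. ?h x - left_regular G s ?h x) = f x" if x: "x \<in> carrier G" for x
  proof -
    have "(\<Sum>s\<in>S. ?h x - left_regular G s ?h x) = laplacian S (\<lambda>s x. inv s \<otimes> x) h x"
      unfolding laplacian_def left_regular_def using x S(2)
      by (intro sum.cong) (auto simp: subset_iff)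
    then show ?thesis using lap[OF x] by simp
  qed
  then have "(\<lambda>x\<in>carrier G. \<Sum>s\<in>S. ?h x - left_regular G s ?h x) = f"
    using f(1) by (auto simp: L2_iff extensional_def)
  then show False
    using invariant_hom_sum_differences[OF \<phi> inv S(1,2) h_L2] f(2) by metis
qed

theorem corollary3:
  fixes G :: "('a, 'b) monoid_scheme"
  assumes "finitely_generated_group G"
  shows "amenable G \<longleftrightarrow>
    (\<exists>\<phi> \<in> hom (L2_group G) circle_group.
       (\<exists>f \<in> L2 G. \<phi> f \<noteq> \<one>\<^bsub>circle_group\<^esub>) \<and>
       (\<forall>f \<in> L2 G. \<forall>g \<in> carrier G. \<phi> f = \<phi> (left_regular G g f)))"
proof -
  interpret group G using assms by (simp add: finitely_generated_group_def)
  obtain S where S: "finite S" "S \<subseteq> carrier G" "generate G S = carrier G"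
    using assms by (auto simp: finitely_generated_group_def)
  show ?thesis
    using amenable_imp_invariant_hom[OF _ S] invariant_hom_imp_amenable[OF _ _ _ _ S] by metis
qed

end
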